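(* Let $\Xi \subset \mathbb{R}^k$ be compact and let $f : \Xi \to \mathbb{R}$ be a continuous function. Let $\mu_0 \in \mathbb{R}^k$, let $\Sigma_0 \in \mathbb{R}^{k\times k}$ be a covariance matrix (symmetric positive definite), let $m_1 > 0$, $m_2 > 0$ and $\varepsilon > 0$. Let $\mathcal{A}_{\mathrm{M}} \subset \mathcal{P}(\Xi)$ be the moment-based ambiguity set $$\mathcal{A}_{\mathrm{M}} = \left\{ \mathbb{Q} \in \mathcal{P}(\Xi) : \ \left| \int_{\Xi} \xi \, \mathrm{d}\mathbb{Q}(\xi) - \mu_0 \right| \leq m_1 \ \text{ and } \ \int_{\Xi} (\xi-\mu_0)\otimes(\xi-\mu_0) \, \mathrm{d}\mathbb{Q}(\xi) \leq m_2 \Sigma_0 \right\},$$ let $\mathbb{Q}_0$ be the normalized restriction to $\Xi$ of the Gaussian law with mean $\mu_0$ and covariance $\Sigma_0$, and let $H(\mathbb{Q})$ be the entropy of $\mathbb{Q}\in\mathcal{P}(\Xi)$ relative to $\mathbb{Q}_0$. Then $$\sup_{\mathbb{Q} \in \mathcal{A}_{\mathrm{M}}} \left( \int_{\Xi} f(\xi) \, \mathrm{d}\mathbb{Q}(\xi) - \varepsilon H(\mathbb{Q}) \right) = \inf_{\substack{\lambda \geq 0, \ \tau \in \mathbb{R}^k, \ |\tau| \leq 1, \\ S \in \mathbb{S}^k_+}} \left\{ \lambda m_1 - \lambda \tau\cdot\mu_0 + m_2\, S : \Sigma_0 + \varepsilon \log\left( \int_{\Xi} e^{\frac{f(\xi)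 + \lambda \tau\cdot\xi - S : (\xi-\mu_0)\otimes(\xi-\mu_0)}{\varepsilon}} \, \mathrm{d}\mathbb{Q}_0(\xi) \right) \right\}.$$
   Context: $\mathcal{P}(\Xi)$ is the set of (Borel) probability measures on $\Xi$. $|\cdot|$ is the Euclidean norm on $\mathbb{R}^k$, $a \otimes b = a b^T$, and $A : B = \mathrm{tr}(A^T B)$ for $k\times k$ matrices. $\mathbb{S}^k_+$ is the set of symmetric positive semi-definite $k\times k$ matrices. The matrix inequality $A \leq B$ means that $B - A$ is positive semi-definite. The reference law $\mathbb{Q}_0 \in \mathcal{P}(\Xi)$ is $$\mathrm{d}\mathbb{Q}_0(\xi) = a\, e^{-\frac12 (\xi-\mu_0)^T \Sigma_0^{-1} (\xi-\mu_0)} \, \mathbf{1}_{\Xi}(\xi) \, \mathrm{d}\xi,$$ where $a > 0$ is the normalization constant making $\mathbb{Q}_0$ a probability measure (so $\Xi$ is assumed to have positive Lebesgue measure). The entropy of $\mathbb{Q} \in \mathcal{P}(\Xi)$ is $$H(\mathbb{Q}) = \begin{cases} \displaystyle\int_{\Xi} \log \frac{\mathrm{d}\mathbb{Q}}{\mathrm{d}\mathbb{Q}_0} \, \mathrm{d}\mathbb{Q} & \text{if } \mathbb{Q} \text{ is absolutely continuous with respect to } \mathbb{Q}_0, \\ +\infty & \text{otherwise.} \end{cases}$$ The supremum of a quantity over an empty set is $-\infty$. *)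

theory Defs
  imports "HOL-Probability.Probability"
begin

definition outer :: "real ^ 'k \<Rightarrow> real ^ 'k \<Rightarrow> real ^ 'k ^ 'k"  (infixl \<open>\<otimes>\<^sub>v\<close> 75)
  where "a \<otimes>\<^sub>v b = (\<chi> i j. a $ i * b $ j)"

definition frobenius :: "real ^ 'k ^ 'k \<Rightarrow> real ^ 'k ^ 'k \<Rightarrow> real"  (infixl \<open>:\<^sub>F\<close> 70)
  where "A :\<^sub>F B = trace (transpose A ** B)"

definition psd_matrices :: "(real ^ 'k ^ 'k) set"
  where "psd_matrices = {A. transpose A = A \<and> (\<forall>x. 0 \<le> x \<bullet> (A *v x))}"

definition pd_matrices :: "(real ^ 'k ^ 'k) set"
  where "pd_matrices = {A. transpose A = A \<and> (\<forall>x. x \<noteq> 0 \<longrightarrow> 0 < x \<bullet> (A *v x))}"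

definition loewner_le :: "real ^ 'k ^ 'k \<Rightarrow> real ^ 'k ^ 'k \<Rightarrow> bool"  (infix \<open>\<le>\<^sub>L\<close> 50)
  where "A \<le>\<^sub>L B \<longleftrightarrow> B - A \<in> psd_matrices"

text \<open>The underlying space of these measures is \<open>\<Xi>\<close> itself, so an integral
  with respect to such a measure is an integral over \<open>\<Xi>\<close>.\<close>

definition prob_measures_on :: "(real ^ 'k) set \<Rightarrow> (real ^ 'k) measure set"
  where "prob_measures_on \<Xi> = space (prob_algebra (restrict_space borel \<Xi>))"

definition moment_ambiguity_set ::
  "(real ^ 'k) set \<Rightarrow> real ^ 'k \<Rightarrow> real ^ 'k ^ 'k \<Rightarrow> real \<Rightarrow> real \<Rightarrow> (real ^ 'k) measure set"
  where "moment_ambiguity_set \<Xi> \<mu>\<^sub>0 \<Sigma>\<^sub>0 m\<^sub>1 m\<^sub>2 =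
    {Q \<in> prob_measures_on \<Xi>.
       norm ((\<integral>\<xi>. \<xi> \<partial>Q) - \<mu>\<^sub>0) \<le> m\<^sub>1 \<and>
       (\<integral>\<xi>. (\<xi> - \<mu>\<^sub>0) \<otimes>\<^sub>v (\<xi> - \<mu>\<^sub>0) \<partial>Q) \<le>\<^sub>L m\<^sub>2 *\<^sub>R \<Sigma>\<^sub>0}"

definition gaussian_weight :: "real ^ 'k \<Rightarrow> real ^ 'k ^ 'k \<Rightarrow> real ^ 'k \<Rightarrow> real"
  where "gaussian_weight \<mu>\<^sub>0 \<Sigma>\<^sub>0 \<xi> =
    exp (- (1 / 2) * ((\<xi> - \<mu>\<^sub>0) \<bullet> (matrix_inv \<Sigma>\<^sub>0 *v (\<xi> - \<mu>\<^sub>0))))"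

definition truncated_gaussian ::
  "(real ^ 'k) set \<Rightarrow> real ^ 'k \<Rightarrow> real ^ 'k ^ 'k \<Rightarrow> (real ^ 'k) measure"
  where "truncated_gaussian \<Xi> \<mu>\<^sub>0 \<Sigma>\<^sub>0 =
    (let a = 1 / (\<integral>\<xi>. gaussian_weight \<mu>\<^sub>0 \<Sigma>\<^sub>0 \<xi> \<partial>restrict_space lborel \<Xi>)
     in density (restrict_space lborel \<Xi>) (\<lambda>\<xi>. ennreal (a * gaussian_weight \<mu>\<^sub>0 \<Sigma>\<^sub>0 \<xi>)))"

text \<open>The Lebesgue integral with values in \<open>[-\<infinity>, \<infinity>]\<close>, positive part minus negative part.
  The library integral \<open>integral\<^sup>L\<close>, and hence \<open>KL_divergence\<close>, returns 0 for
  non-integrable functions. It would give relative entropy 0, instead of \<open>\<infinity>\<close>, to an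
  absolutely continuous law with non-integrable log-density.\<close>

definition ereal_integral :: "'a measure \<Rightarrow> ('a \<Rightarrow> real) \<Rightarrow> ereal"
  where "ereal_integral M g =
    enn2ereal (\<integral>\<^sup>+x. ennreal (g x) \<partial>M) - enn2ereal (\<integral>\<^sup>+x. ennreal (- g x) \<partial>M)"

text \<open>For probability measures the negative part of the log-density has a finite integral
  (at most \<open>1 / exp 1\<close>), so the difference in \<open>ereal_integral\<close> is never \<open>\<infinity> - \<infinity>\<close> here.
  The values of \<open>ln\<close> and \<open>enn2real\<close> at \<open>0\<close> and \<open>\<infinity>\<close> are only used on a \<open>Q\<close>-null set.\<close>

definition rel_entropy :: "'a measure \<Rightarrow> 'a measure \<Rightarrow> ereal"
  where "rel_entropy Q\<^sub>0 Q =
    (if absolutely_continuous Q\<^sub>0 Q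
     then ereal_integral Q (\<lambda>\<xi>. ln (enn2real (RN_deriv Q\<^sub>0 Q \<xi>)))
     else \<infinity>)"

end

theory Submission
  imports Defs
begin

text \<open>The supremum is a concave maximisation problem over densities \<open>q\<close> with respect to the truncated
Gaussian: the objective is the integral of \<open>q f\<close> minus \<open>\<epsilon>\<close> times the integral of \<open>q ln q\<close>, and the
constraint asks that the first two moments of \<open>q\<close> lie in a closed convex set \<open>K\<close>. The multiplier of
the ball constraint on the mean is the vector \<open>l \<tau>\<close>, with \<open>l\<close> its length; the multiplier of the matrix
inequality is \<open>S\<close>. For fixed multipliers the maximisation over all \<open>q\<close> is explicit, since the Gibbs
variational principle gives \<open>\<epsilon>\<close> times a log-partition function (\<open>Gibbs_inequality\<close>,
\<open>Gibbs_density_attains\<close>). Weak duality follows, given that two positive semi-definite matrices have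
a nonnegative inner product (\<open>psd_inner_nonneg\<close>).

Strong duality has to hold without a Slater condition: there may be no feasible measure with finite
entropy, or only boundary ones. It holds because of a closedness property: if the
constraint can be met up to every error with value nearly \<open>s\<close>, it can be met exactly with value at
least \<open>s\<close> (\<open>approximate_feasibility_imp_feasibility\<close>). The usual
argument is weak compactness of entropy sublevel sets. Here uniform concavity does the work: the
midpoint of two nearly optimal densities would be better than optimal unless they are close in
\<open>L\<^sup>1\<close>, so nearly optimal densities form an \<open>L\<^sup>1\<close> Cauchy sequence, and Fatou's lemma controls the
entropy of the limit.

Consequently, for \<open>s\<close> above the primal value, the origin is not in the closure of the convex set of
pairs (constraint violation, missing value), which is a subset of a finite-dimensional space. A
separating hyperplane gives a linear functional of the moments whose dual value is at most \<open>s\<close>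
(\<open>dual_certificate\<close>), also when the hyperplane is vertical. Finally the shape of \<open>K\<close> forces this
functional to act as \<open>(l \<tau>, - S)\<close> on pairs with a symmetric second component
(\<open>multipliers_of_functional\<close>).\<close>

section \<open>The function x ln x\<close>

text \<open>The convexity defect of \<open>x ln x\<close> at a midpoint controls the squared Hellinger distance.
With \<open>m\<close> the midpoint, the defect is half the sum of \<open>x ln (x / m)\<close> over the two points, and
\<open>ln z \<le> z - 1\<close> at \<open>z = sqrt (m / x)\<close> bounds each term below by \<open>2 x - 2 sqrt (x m)\<close>; these two
bounds add up to \<open>(sqrt a - sqrt m)\<^sup>2 + (sqrt b - sqrt m)\<^sup>2\<close>, which is at least half of
\<open>(sqrt a - sqrt b)\<^sup>2\<close>.\<close>

lemma entropy_gap_ge_Hellinger: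
  fixes a b :: real
  assumes "0 \<le> a" "0 \<le> b"
  shows "(sqrt a - sqrt b)\<^sup>2 / 4 \<le> (a * ln a + b * ln b) / 2 - (a + b) / 2 * ln ((a + b) / 2)"
proof (cases "a + b = 0")
  case True
  then have "a = 0" "b = 0" using assms by auto
  then show ?thesis by simp
next
  case False
  define m where "m = (a + b) / 2"
  have m: "m > 0" using False assms by (simp add: m_def)
  have *: "x - 2 * (sqrt x * sqrt m) + x \<le> x * ln x - x * ln m" if "0 \<le> x" for x
  proof (cases "x = 0")
    case False
    then have x: "x > 0" using that by simp
    have "ln (sqrt (m / x)) \<le> sqrt (m / x) - 1"
      by (rule ln_le_minus_one) (use m x in simp)
    moreover have "ln (sqrt (m / x)) = (ln m - ln x) / 2"
      using m x by (simp add: ln_sqrt ln_div)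
    ultimately have "ln m - ln x \<le> 2 * sqrt (m / x) - 2" by simp
    then have "x * (ln m - ln x) \<le> x * (2 * sqrt (m / x) - 2)"
      using x by (intro mult_left_mono) auto
    moreover have "x * sqrt (m / x) = sqrt x * sqrt m"
      using x by (simp add: real_sqrt_divide real_div_sqrt field_simps)
        
    ultimately show ?thesis by (simp add: algebra_simps)
  qed simp
  have sa: "sqrt a * sqrt a = a" "sqrt b * sqrt b = b" "sqrt m * sqrt m = m"
    using assms m by auto
  have "(sqrt a - sqrt b)\<^sup>2 + (sqrt a + sqrt b - 2 * sqrt m)\<^sup>2
      = 2 * ((sqrt a - sqrt m)\<^sup>2 + (sqrt b - sqrt m)\<^sup>2)"
    by (simp add: power2_eq_square algebra_simps)
  then have "(sqrt a - sqrt b)\<^sup>2 / 4 \<le> ((sqrt a - sqrt m)\<^sup>2 + (sqrt b - sqrt m)\<^sup>2) / 2"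
    using zero_le_power2[of "sqrt a + sqrt b - 2 * sqrt m"] by linarith
  also have "\<dots> = (2 * a + 2 * b - 2 * (sqrt a * sqrt m) - 2 * (sqrt b * sqrt m)) / 2"
    using sa by (simp add: power2_eq_square algebra_simps m_def)
  also have "\<dots> \<le> (a * ln a + b * ln b) / 2 - m * ln m"
  proof -
    have "a * ln m + b * ln m = 2 * (m * ln m)" by (simp add: m_def algebra_simps add_divide_distrib)
    then show ?thesis using *[OF assms(1)] *[OF assms(2)] by argo
  qed
  finally show ?thesis by (simp add: m_def)
qed

text \<open>A pointwise substitute for Pinsker's inequality: factor \<open>a - b\<close> as a difference of squares of
square roots and split the product by the arithmetic-geometric mean inequality with weight \<open>\<theta>\<close>.
For two densities the first term integrates to \<open>2 \<theta>\<close>, so a small mean convexity defect forces a small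
\<open>L\<^sup>1\<close> distance.\<close>

lemma abs_diff_le_entropy_gap:
  fixes a b \<theta> :: real
  assumes "0 \<le> a" "0 \<le> b" "\<theta> > 0"
  shows "\<bar>a - b\<bar> \<le> \<theta> * (a + b)
     + 2 / \<theta> * ((a * ln a + b * ln b) / 2 - (a + b) / 2 * ln ((a + b) / 2))"
proof -
  let ?G = "(a * ln a + b * ln b) / 2 - (a + b) / 2 * ln ((a + b) / 2)"
  have sq: "sqrt a * sqrt a = a" "sqrt b * sqrt b = b" using assms by auto
  have "a - b = (sqrt a - sqrt b) * (sqrt a + sqrt b)"
    using sq by (simp add: algebra_simps)
  then have e: "\<bar>a - b\<bar> = \<bar>sqrt a - sqrt b\<bar> * (sqrt a + sqrt b)"
    using assms by (simp add: abs_mult)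
  have "2 * (\<theta> * (sqrt a + sqrt b)) * \<bar>sqrt a - sqrt b\<bar>
      \<le> (\<theta> * (sqrt a + sqrt b))\<^sup>2 + \<bar>sqrt a - sqrt b\<bar>\<^sup>2"
    by (rule sum_squares_bound)
  then have "2 * \<theta> * (\<bar>sqrt a - sqrt b\<bar> * (sqrt a + sqrt b))
      \<le> \<theta>\<^sup>2 * (sqrt a + sqrt b)\<^sup>2 + (sqrt a - sqrt b)\<^sup>2"
    by (simp only: power2_abs power_mult_distrib mult_ac)
  moreover have "(sqrt a + sqrt b)\<^sup>2 \<le> 2 * (a + b)"
    using sq zero_le_power2[of "sqrt a - sqrt b"]
    by (simp add: power2_eq_square algebra_simps)
  then have "\<theta>\<^sup>2 * (sqrt a + sqrt b)\<^sup>2 \<le> \<theta>\<^sup>2 * (2 * (a + b))"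
    by (rule mult_left_mono) simp
  moreover have "(sqrt a - sqrt b)\<^sup>2 \<le> 4 * ?G"
    using entropy_gap_ge_Hellinger[OF assms(1,2)] by argo
  ultimately have "2 * \<theta> * \<bar>a - b\<bar> \<le> \<theta>\<^sup>2 * (2 * (a + b)) + 4 * ?G"
    unfolding e by linarith
  also have "\<dots> = 2 * \<theta> * (\<theta> * (a + b) + 2 / \<theta> * ?G)"
    using assms(3) by (simp add: power2_eq_square distrib_left)
  finally show ?thesis using assms(3) by simp
qed

text \<open>The convex function \<open>x ln x\<close> lies above its tangent at \<open>m\<close>. This one inequality yields the lower
bound \<open>-1\<close>, Jensen's inequality for two points and the Gibbs variational inequality.\<close>

lemma mult_ln_tangent: "x * ln m + x - m \<le> x * ln x" if "0 \<le> x" "0 < m" for x m :: real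
proof (cases "x = 0")
  case False
  then have x: "x > 0" using that by simp
  have "ln (m / x) \<le> m / x - 1" using x that by (intro ln_le_minus_one) simp
  then have "x * ln (m / x) \<le> x * (m / x - 1)" using x by (intro mult_left_mono) auto
  then show ?thesis using x that by (simp add: ln_div algebra_simps)
qed (use that in simp)

lemma mult_ln_ge: "- 1 \<le> x * ln x" if "0 \<le> x" for x :: real
  using mult_ln_tangent[OF that, of 1] that by simp

lemma mult_ln_convex:
  fixes x y u v :: real
  assumes "0 \<le> x" "0 \<le> y" "0 \<le> u" "0 \<le> v" "u + v = 1"
  shows "(u * x + v * y) * ln (u * x + v * y) \<le> u * (x * ln x) + v * (y * ln y)"
proof (cases "u * x + v * y = 0")
  case True
  then have "u * x = 0" "v * y = 0"
    using assms by (auto simp: add_nonneg_eq_0_iff)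
  then show ?thesis by auto
next
  case False
  define m where "m = u * x + v * y"
  have m: "m > 0" using False assms by (simp add: m_def less_le)
  have "u * (x * ln m + x - m) + v * (y * ln m + y - m) \<le> u * (x * ln x) + v * (y * ln y)"
    using assms mult_ln_tangent[OF _ m] by (intro add_mono mult_left_mono) auto
  moreover have "u * (x * ln m + x - m) + v * (y * ln m + y - m) = m * ln m + m - (u + v) * m"
    by (simp add: m_def algebra_simps)
  ultimately show ?thesis using assms by (simp add: m_def)
qed

text \<open>This makes \<open>x ln x\<close> continuous at \<open>0\<close>, from both sides because \<open>ln\<close> is extended to the negative
reals as an even function.\<close>

lemma abs_mult_ln_le: "\<bar>x * ln x\<bar> \<le> 2 * sqrt \<bar>x\<bar>" if "\<bar>x\<bar> \<le> 1" for x :: real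
proof (cases "x = 0")
  case False
  define y where "y = \<bar>x\<bar>"
  have y: "0 < y" "y \<le> 1" using False that by (auto simp: y_def)
  have "ln (1 / sqrt y) \<le> 1 / sqrt y - 1" using y by (intro ln_le_minus_one) simp
  then have "- ln y \<le> 2 / sqrt y" using y by (simp add: ln_div ln_sqrt)
  then have "y * - ln y \<le> y * (2 / sqrt y)" using y by (intro mult_left_mono) auto
  also have "\<dots> = 2 * sqrt y" using y real_div_sqrt[of y] by (simp add: field_simps)
  finally have "y * - ln y \<le> 2 * sqrt y" .
  moreover have "\<bar>x * ln x\<bar> = y * - ln y"
  proof -
    have "ln y = ln x" by (simp add: y_def abs_if ln_minus)
    moreover have "ln y \<le> 0" using y by simp
    ultimately show ?thesis by (simp add: y_def abs_mult)
  qed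
  ultimately show ?thesis by (simp add: y_def)
qed simp

lemma isCont_mult_ln: "isCont (\<lambda>x::real. x * ln x) a" if "0 \<le> a"
proof (cases "a = 0")
  case True
  have "((\<lambda>x::real. x * ln x) \<longlongrightarrow> 0) (at 0)"
  proof (rule Lim_null_comparison)
    show "\<forall>\<^sub>F x in at 0. norm (x * ln x) \<le> 2 * sqrt \<bar>x\<bar>" for x :: real
      unfolding eventually_at using abs_mult_ln_le by (intro exI[of _ 1]) (auto simp: dist_real_def)
    show "((\<lambda>x::real. 2 * sqrt \<bar>x\<bar>) \<longlongrightarrow> 0) (at 0)"
      by (auto intro!: tendsto_eq_intros)
  qed
  then show ?thesis using True by (simp add: isCont_def)
qed (use that in \<open>auto intro!: continuous_intros\<close>)

section \<open>Completeness of the space of integrable functions\<close>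

text \<open>Completeness of \<open>L\<^sup>1\<close>, keeping the almost everywhere convergent subsequence because the entropy
will be passed to the limit by Fatou's lemma. Fatou's lemma also turns the Cauchy estimate into
convergence in mean.\<close>

lemma L1_Cauchy_convergent_subseq:
  fixes s :: "nat \<Rightarrow> 'a \<Rightarrow> real"
  assumes int: "\<And>n. integrable M (s n)"
    and Cauchy: "\<And>e. e > 0 \<Longrightarrow> \<exists>N. \<forall>i\<ge>N. \<forall>j\<ge>N. (\<integral>x. \<bar>s i x - s j x\<bar> \<partial>M) < e"
  obtains r q where "strict_mono r" "integrable M q"
    "AE x in M. (\<lambda>i. s (r i) x) \<longlonglongrightarrow> q x"
    "(\<lambda>i. \<integral>x. \<bar>s (r i) x - q x\<bar> \<partial>M) \<longlonglongrightarrow> 0"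
proof -
  have [measurable]: "s n \<in> borel_measurable M" for n using int by auto
  obtain r where r: "strict_mono r" and c: "AE x in M. Cauchy (\<lambda>i. s (r i) x)"
    using cauchy_L1_AE_cauchy_subseq[of M s] assms by auto
  define q where "q x = lim (\<lambda>i. s (r i) x)" for x
  have [measurable]: "q \<in> borel_measurable M"
    unfolding q_def by (rule borel_measurable_lim_metric) simp
  have lim: "AE x in M. (\<lambda>i. s (r i) x) \<longlonglongrightarrow> q x"
    using c by eventually_elim (simp add: q_def Cauchy_convergent_iff convergent_LIMSEQ_iff)
  have bound: "\<exists>N. \<forall>i\<ge>N. (\<integral>\<^sup>+x. ennreal \<bar>s (r i) x - q x\<bar> \<partial>M) \<le> ennreal e" if "e > 0" for e
  proof -
    obtain N where N: "\<And>i j. i \<ge> N \<Longrightarrow> j \<ge> N \<Longrightarrow> (\<integral>x. \<bar>s i x - s j x\<bar> \<partial>M) < e"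
      using Cauchy[OF \<open>e > 0\<close>] by auto
    have "(\<integral>\<^sup>+x. ennreal \<bar>s (r i) x - q x\<bar> \<partial>M) \<le> ennreal e" if "i \<ge> N" for i
    proof -
      have "(\<integral>\<^sup>+x. ennreal \<bar>s (r i) x - q x\<bar> \<partial>M)
          = (\<integral>\<^sup>+x. liminf (\<lambda>j. ennreal \<bar>s (r i) x - s (r j) x\<bar>) \<partial>M)"
      proof (rule nn_integral_cong_AE, use lim in eventually_elim)
        case (elim x)
        then have "(\<lambda>j. ennreal \<bar>s (r i) x - s (r j) x\<bar>) \<longlonglongrightarrow> ennreal \<bar>s (r i) x - q x\<bar>"
          by (intro tendsto_intros)
        then show ?case by (intro lim_imp_Liminf[symmetric]) auto
      qed
      also have "\<dots> \<le> liminf (\<lambda>j. \<integral>\<^sup>+x. ennreal \<bar>s (r i) x - s (r j) x\<bar> \<partial>M)"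
        by (rule nn_integral_liminf) simp
      also have "\<dots> \<le> liminf (\<lambda>j::nat. ennreal e)"
      proof (rule Liminf_mono, rule eventually_sequentiallyI[of N])
        fix j assume "j \<ge> N"
        have "(\<integral>\<^sup>+x. ennreal \<bar>s (r i) x - s (r j) x\<bar> \<partial>M) = ennreal (\<integral>x. \<bar>s (r i) x - s (r j) x\<bar> \<partial>M)"
          using int by (intro nn_integral_eq_integral) auto
        also have "\<dots> \<le> ennreal e"
          using N[of "r i" "r j"] \<open>i \<ge> N\<close> \<open>j \<ge> N\<close> seq_suble[OF r, of i] seq_suble[OF r, of j]
          by (intro ennreal_leI) (meson le_trans less_imp_le)
        finally show "(\<integral>\<^sup>+x. ennreal \<bar>s (r i) x - s (r j) x\<bar> \<partial>M) \<le> ennreal e" .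
      qed
      also have "\<dots> = ennreal e" by (simp add: Liminf_const)
      finally show ?thesis .
    qed
    then show ?thesis by blast
  qed
  have q: "integrable M q"
  proof -
    obtain i where i: "(\<integral>\<^sup>+x. ennreal \<bar>s (r i) x - q x\<bar> \<partial>M) \<le> ennreal 1"
      using bound[of 1] by auto
    have "integrable M (\<lambda>x. s (r i) x - q x)"
      by (rule integrableI_bounded) (use i in \<open>auto intro: le_less_trans[OF _ ennreal_less_top[of 1]]\<close>)
    from Bochner_Integration.integrable_diff[OF int[of "r i"] this] show ?thesis by simp
  qed
  have "(\<lambda>i. \<integral>x. \<bar>s (r i) x - q x\<bar> \<partial>M) \<longlonglongrightarrow> 0"
  proof (rule LIMSEQ_I)
    fix e :: real assume "e > 0"
    then obtain N where N: "\<And>i. i \<ge> N \<Longrightarrow> (\<integral>\<^sup>+x. ennreal \<bar>s (r i) x - q x\<bar> \<partial>M) \<le> ennreal (e / 2)"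
      using bound[of "e / 2"] by auto
    have "(\<integral>x. \<bar>s (r i) x - q x\<bar> \<partial>M) \<le> e / 2" if "i \<ge> N" for i
    proof -
      have "ennreal (\<integral>x. \<bar>s (r i) x - q x\<bar> \<partial>M) = (\<integral>\<^sup>+x. ennreal \<bar>s (r i) x - q x\<bar> \<partial>M)"
        using int q by (intro nn_integral_eq_integral[symmetric]) auto
      also have "\<dots> \<le> ennreal (e / 2)" by (rule N[OF that])
      finally show ?thesis using \<open>e > 0\<close> by (subst (asm) ennreal_le_iff) auto
    qed
    then show "\<exists>no. \<forall>n\<ge>no. norm ((\<integral>x. \<bar>s (r n) x - q x\<bar> \<partial>M) - 0) < e"
      using \<open>e > 0\<close> by (intro exI[of _ N]) fastforce
  qed
  then show ?thesis using that r q lim by blast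
qed

section \<open>Uniform concavity of the entropic objective\<close>

text \<open>The densities of the probability measures with finite entropy relative to \<open>M\<close>. Nonnegativity is
required everywhere, not almost everywhere, so that pointwise inequalities need no exceptional set.\<close>

definition entropy_densities :: "'a measure \<Rightarrow> ('a \<Rightarrow> real) set"
  where "entropy_densities M =
    {q. (\<forall>x. 0 \<le> q x) \<and> integrable M q \<and> (\<integral>x. q x \<partial>M) = 1 \<and> integrable M (\<lambda>x. q x * ln (q x))}"

text \<open>Maximising an expected payoff \<open>f\<close> minus \<open>\<epsilon>\<close> times the entropy relative to \<open>M\<close>, under a constraint on
the moments \<open>h\<close> that take values in a Euclidean space. One constant \<open>B\<close> bounds both \<open>f\<close> and \<open>h\<close>.\<close>

locale moment_problem = prob_space M
  for M :: "'a measure" +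
  fixes f :: "'a \<Rightarrow> real" and h :: "'a \<Rightarrow> 'v :: euclidean_space" and B \<epsilon> :: real
  assumes f_measurable [measurable]: "f \<in> borel_measurable M"
    and h_measurable [measurable]: "h \<in> borel_measurable M"
    and f_bound: "\<And>x. x \<in> space M \<Longrightarrow> \<bar>f x\<bar> \<le> B"
    and h_bound: "\<And>x. x \<in> space M \<Longrightarrow> norm (h x) \<le> B"
    and eps_pos: "0 < \<epsilon>"
begin

definition moment :: "('a \<Rightarrow> real) \<Rightarrow> 'v"
  where "moment q = (\<integral>x. q x *\<^sub>R h x \<partial>M)"

definition objective :: "('a \<Rightarrow> real) \<Rightarrow> real"
  where "objective q = (\<integral>x. q x * f x \<partial>M) - \<epsilon> * (\<integral>x. q x * ln (q x) \<partial>M)"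

lemma integrable_scaleR_bounded:
  fixes g :: "'a \<Rightarrow> 'w :: euclidean_space"
  assumes q: "integrable M q" and [measurable]: "g \<in> borel_measurable M"
    and b: "\<And>x. x \<in> space M \<Longrightarrow> norm (g x) \<le> C"
  shows "integrable M (\<lambda>x. q x *\<^sub>R g x)"
proof (rule Bochner_Integration.integrable_bound)
  show "integrable M (\<lambda>x. q x * C)" using q by simp
  show "(\<lambda>x. q x *\<^sub>R g x) \<in> borel_measurable M" using q by measurable
  have "norm (q x *\<^sub>R g x) \<le> norm (q x * C)" if "x \<in> space M" for x
    using mult_left_mono[OF order.trans[OF b[OF that] abs_ge_self[of C]], of "\<bar>q x\<bar>"] by (simp add: abs_mult)
  then show "AE x in M. norm (q x *\<^sub>R g x) \<le> norm (q x * C)" by auto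
qed

lemma integrable_density_f: "q \<in> entropy_densities M \<Longrightarrow> integrable M (\<lambda>x. q x * f x)"
  using integrable_scaleR_bounded[of q f B] f_bound by (simp add: entropy_densities_def)

lemma integrable_density_h: "q \<in> entropy_densities M \<Longrightarrow> integrable M (\<lambda>x. q x *\<^sub>R h x)"
  using integrable_scaleR_bounded[of q h B] h_bound by (simp add: entropy_densities_def)

lemma objective_le: "objective q \<le> B + \<epsilon>" if q: "q \<in> entropy_densities M"
proof -
  note d = q[unfolded entropy_densities_def, simplified]
  have "(\<integral>x. q x * f x \<partial>M) \<le> (\<integral>x. q x * B \<partial>M)"
  proof (rule integral_mono)
    show "q x * f x \<le> q x * B" if "x \<in> space M" for x
      using d f_bound[OF that] by (intro mult_left_mono) auto
  qed (use integrable_density_f[OF q] d in auto)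
  also have "\<dots> = B" using d by simp
  finally have 1: "(\<integral>x. q x * f x \<partial>M) \<le> B" .
  have "(\<integral>x. - 1 \<partial>M) \<le> (\<integral>x. q x * ln (q x) \<partial>M)"
    using d mult_ln_ge by (intro integral_mono) auto
  then have "\<epsilon> * (- 1) \<le> \<epsilon> * (\<integral>x. q x * ln (q x) \<partial>M)"
    using eps_pos by (intro mult_left_mono) (auto simp: prob_space)
  with 1 show ?thesis by (simp add: objective_def)
qed

text \<open>The constraint is affine and the objective concave in the density. The integral in the exact
formula for the objective is the mean convexity defect of the entropy; it measures how strictly
concave the objective is.\<close>

lemma mixture:
  assumes q: "q \<in> entropy_densities M" and p: "p \<in> entropy_densities M"
    and uv: "0 \<le> u" "0 \<le> v" "u + v = 1"
  defines "w \<equiv> \<lambda>x. u * q x + v * p x"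
  shows mixture_density: "w \<in> entropy_densities M"
    and moment_mixture: "moment w = u *\<^sub>R moment q + v *\<^sub>R moment p"
    and objective_mixture: "objective w = u * objective q + v * objective p
      + \<epsilon> * (\<integral>x. u * (q x * ln (q x)) + v * (p x * ln (p x)) - w x * ln (w x) \<partial>M)"
    and objective_mixture_ge: "u * objective q + v * objective p \<le> objective w"
proof -
  note dq = q[unfolded entropy_densities_def, simplified]
  note dp = p[unfolded entropy_densities_def, simplified]
  let ?U = "\<lambda>x. u * (q x * ln (q x)) + v * (p x * ln (p x))"
  have [measurable]: "q \<in> borel_measurable M" "p \<in> borel_measurable M" using dq dp by auto
  have w0: "0 \<le> w x" for x using dq dp uv by (simp add: w_def)
  have convex: "w x * ln (w x) \<le> ?U x" for x
    unfolding w_def using dq dp uv by (intro mult_ln_convex) auto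
  have intU: "integrable M ?U" using dq dp by auto
  have intW: "integrable M (\<lambda>x. w x * ln (w x))"
  proof (rule Bochner_Integration.integrable_bound)
    show "integrable M (\<lambda>x. \<bar>?U x\<bar> + 1)" using intU by auto
    show "(\<lambda>x. w x * ln (w x)) \<in> borel_measurable M" unfolding w_def by measurable
    show "AE x in M. norm (w x * ln (w x)) \<le> norm (\<bar>?U x\<bar> + 1)"
    proof (rule AE_I2)
      fix x show "norm (w x * ln (w x)) \<le> norm (\<bar>?U x\<bar> + 1)"
        using convex[of x] mult_ln_ge[OF w0[of x]] by (simp add: abs_le_iff del: mult_minus_left) linarith
    qed
  qed
  show w: "w \<in> entropy_densities M"
    using w0 intW dq dp uv by (auto simp: entropy_densities_def w_def)
  have "moment w = (\<integral>x. u *\<^sub>R (q x *\<^sub>R h x) + v *\<^sub>R (p x *\<^sub>R h x) \<partial>M)"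
    by (simp add: moment_def w_def scaleR_add_left)
  also have "\<dots> = u *\<^sub>R moment q + v *\<^sub>R moment p"
    unfolding moment_def using integrable_density_h[OF q] integrable_density_h[OF p]
    by (simp del: scaleR_scaleR)
  finally show "moment w = u *\<^sub>R moment q + v *\<^sub>R moment p" .
  have f: "(\<integral>x. w x * f x \<partial>M) = u * (\<integral>x. q x * f x \<partial>M) + v * (\<integral>x. p x * f x \<partial>M)"
  proof -
    have "(\<integral>x. w x * f x \<partial>M) = (\<integral>x. u * (q x * f x) + v * (p x * f x) \<partial>M)"
      by (simp add: w_def algebra_simps)
    also have "\<dots> = u * (\<integral>x. q x * f x \<partial>M) + v * (\<integral>x. p x * f x \<partial>M)"
      using integrable_density_f[OF q] integrable_density_f[OF p] by simp
    finally show ?thesis .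
  qed
  have gap: "(\<integral>x. ?U x - w x * ln (w x) \<partial>M)
      = u * (\<integral>x. q x * ln (q x) \<partial>M) + v * (\<integral>x. p x * ln (p x) \<partial>M) - (\<integral>x. w x * ln (w x) \<partial>M)"
    using intU intW dq dp by simp
  show *: "objective w = u * objective q + v * objective p + \<epsilon> * (\<integral>x. ?U x - w x * ln (w x) \<partial>M)"
    unfolding gap objective_def f by (simp add: algebra_simps)
  have "0 \<le> (\<integral>x. ?U x - w x * ln (w x) \<partial>M)"
    using convex by (intro integral_nonneg_AE) auto
  then show "u * objective q + v * objective p \<le> objective w"
    using eps_pos by (simp add: *)
qed

text \<open>This is the sense in which the objective is uniformly concave. It makes maximising sequences over
convex sets Cauchy in \<open>L\<^sup>1\<close>.\<close>

lemma L1_dist_le_objective_gap: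
  assumes q: "q \<in> entropy_densities M" and p: "p \<in> entropy_densities M" and "\<theta> > 0"
  shows "(\<integral>x. \<bar>q x - p x\<bar> \<partial>M) \<le> 2 * \<theta> + 2 / (\<theta> * \<epsilon>) *
    (objective (\<lambda>x. 1/2 * q x + 1/2 * p x) - (objective q + objective p) / 2)"
proof -
  note dq = q[unfolded entropy_densities_def, simplified]
  note dp = p[unfolded entropy_densities_def, simplified]
  define w where "w = (\<lambda>x. 1/2 * q x + 1/2 * p x)"
  let ?G = "\<lambda>x. 1/2 * (q x * ln (q x)) + 1/2 * (p x * ln (p x)) - w x * ln (w x)"
  have w: "w \<in> entropy_densities M"
    unfolding w_def by (rule mixture_density[OF q p]) auto
  have obj: "objective w - (objective q + objective p) / 2 = \<epsilon> * (\<integral>x. ?G x \<partial>M)"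
    using objective_mixture[OF q p, of "1/2" "1/2"] by (simp add: w_def add_divide_distrib)
  have intG: "integrable M ?G"
    using dq dp w by (auto simp: entropy_densities_def)
  have "\<bar>q x - p x\<bar> \<le> \<theta> * (q x + p x) + 2 / \<theta> * ?G x" for x
    using abs_diff_le_entropy_gap[of "q x" "p x" \<theta>] dq dp \<open>\<theta> > 0\<close>
    by (simp add: w_def add_divide_distrib)
  then have "(\<integral>x. \<bar>q x - p x\<bar> \<partial>M) \<le> (\<integral>x. \<theta> * (q x + p x) + 2 / \<theta> * ?G x \<partial>M)"
  proof (intro integral_mono)
    show "integrable M (\<lambda>x. \<theta> * (q x + p x) + 2 / \<theta> * ?G x)"
      using intG dq dp by (intro Bochner_Integration.integrable_add integrable_mult_right) auto
  qed (use dq dp in auto)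
  also have "\<dots> = 2 * \<theta> + 2 / \<theta> * (\<integral>x. ?G x \<partial>M)"
  proof -
    have "integrable M (\<lambda>x. \<theta> * (q x + p x))" using dq dp by auto
    moreover have "integrable M (\<lambda>x. 2 / \<theta> * ?G x)" using intG by (rule integrable_mult_right)
    ultimately have "(\<integral>x. \<theta> * (q x + p x) + 2 / \<theta> * ?G x \<partial>M)
        = (\<integral>x. \<theta> * (q x + p x) \<partial>M) + (\<integral>x. 2 / \<theta> * ?G x \<partial>M)"
      by (rule Bochner_Integration.integral_add)
    also have "(\<integral>x. \<theta> * (q x + p x) \<partial>M) = 2 * \<theta>" using dq dp by simp
    also have "(\<integral>x. 2 / \<theta> * ?G x \<partial>M) = 2 / \<theta> * (\<integral>x. ?G x \<partial>M)"
      by (rule integral_mult_right_zero)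
    finally show ?thesis .
  qed
  also have "2 / \<theta> * (\<integral>x. ?G x \<partial>M)
      = 2 / (\<theta> * \<epsilon>) * (objective w - (objective q + objective p) / 2)"
    unfolding obj using eps_pos by simp
  finally show ?thesis by (simp add: w_def)
qed

lemma tendsto_integral_L1:
  fixes g :: "'a \<Rightarrow> 'w :: euclidean_space"
  assumes s: "\<And>n. integrable M (s n)" and q: "integrable M q"
    and lim: "(\<lambda>n. \<integral>x. \<bar>s n x - q x\<bar> \<partial>M) \<longlonglongrightarrow> 0"
    and g [measurable]: "g \<in> borel_measurable M" and b: "\<And>x. x \<in> space M \<Longrightarrow> norm (g x) \<le> C"
  shows "(\<lambda>n. \<integral>x. s n x *\<^sub>R g x \<partial>M) \<longlonglongrightarrow> (\<integral>x. q x *\<^sub>R g x \<partial>M)"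
proof (rule LIM_zero_cancel, rule Lim_null_comparison)
  have "norm ((\<integral>x. s n x *\<^sub>R g x \<partial>M) - (\<integral>x. q x *\<^sub>R g x \<partial>M)) \<le> C * (\<integral>x. \<bar>s n x - q x\<bar> \<partial>M)" for n
  proof -
    have i: "integrable M (\<lambda>x. s n x *\<^sub>R g x)" "integrable M (\<lambda>x. q x *\<^sub>R g x)"
      using integrable_scaleR_bounded[OF _ g b] s q by auto
    have "(\<integral>x. s n x *\<^sub>R g x \<partial>M) - (\<integral>x. q x *\<^sub>R g x \<partial>M) = (\<integral>x. (s n x - q x) *\<^sub>R g x \<partial>M)"
      using i by (simp add: scaleR_diff_left)
    also have "norm \<dots> \<le> (\<integral>x. norm ((s n x - q x) *\<^sub>R g x) \<partial>M)"
      by (rule integral_norm_bound)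
    also have "\<dots> \<le> (\<integral>x. C * \<bar>s n x - q x\<bar> \<partial>M)"
    proof (rule integral_mono)
      show "integrable M (\<lambda>x. norm ((s n x - q x) *\<^sub>R g x))"
        using i by (intro integrable_norm) (simp add: scaleR_diff_left)
      show "integrable M (\<lambda>x. C * \<bar>s n x - q x\<bar>)" using s q by auto
      fix x assume "x \<in> space M"
      then show "norm ((s n x - q x) *\<^sub>R g x) \<le> C * \<bar>s n x - q x\<bar>"
        using mult_right_mono[OF b, of x "\<bar>s n x - q x\<bar>"] by (simp add: mult.commute)
    qed
    finally show ?thesis by simp
  qed
  then show "\<forall>\<^sub>F n in sequentially. norm ((\<integral>x. s n x *\<^sub>R g x \<partial>M) - (\<integral>x. q x *\<^sub>R g x \<partial>M)) \<le> C * (\<integral>x. \<bar>s n x - q x\<bar> \<partial>M)"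
    by simp
  show "(\<lambda>n. C * (\<integral>x. \<bar>s n x - q x\<bar> \<partial>M)) \<longlonglongrightarrow> 0"
    using tendsto_mult_left[OF lim, of C] by simp
qed

section \<open>Nearly feasible densities\<close>

text \<open>The objective is upper semicontinuous along \<open>L\<^sup>1\<close> convergent densities: the payoff and the moments
converge, and Fatou's lemma applies to \<open>q ln q + 1 \<ge> 0\<close>. The almost everywhere limit is replaced by
its positive part to obtain a density that is nonnegative everywhere.\<close>

lemma density_limit:
  assumes s: "\<And>n. s n \<in> entropy_densities M" and q: "integrable M q"
    and ae: "AE x in M. (\<lambda>n. s n x) \<longlonglongrightarrow> q x"
    and L1: "(\<lambda>n. \<integral>x. \<bar>s n x - q x\<bar> \<partial>M) \<longlonglongrightarrow> 0"
    and obj: "\<And>n. c n \<le> objective (s n)" "c \<longlonglongrightarrow> c0"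
  obtains p where "p \<in> entropy_densities M" "(\<lambda>n. moment (s n)) \<longlonglongrightarrow> moment p"
    "c0 \<le> objective p"
proof -
  note ds = s[unfolded entropy_densities_def, simplified]
  define p where "p x = max 0 (q x)" for x
  have [measurable]: "q \<in> borel_measurable M" "s n \<in> borel_measurable M" for n
    using q ds by auto
  have pq: "AE x in M. p x = q x"
    using ae
  proof eventually_elim
    case (elim x)
    then have "0 \<le> q x" by (rule LIMSEQ_le_const) (use ds in auto)
    then show ?case by (simp add: p_def)
  qed
  have p: "integrable M p" unfolding p_def using q by auto
  have "(\<integral>x. \<bar>s n x - p x\<bar> \<partial>M) = (\<integral>x. \<bar>s n x - q x\<bar> \<partial>M)" for n
    by (rule integral_cong_AE) (use pq p in auto)
  then have L1p: "(\<lambda>n. \<integral>x. \<bar>s n x - p x\<bar> \<partial>M) \<longlonglongrightarrow> 0" using L1 by simp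
  have lim: "(\<lambda>n. \<integral>x. s n x *\<^sub>R g x \<partial>M) \<longlonglongrightarrow> (\<integral>x. p x *\<^sub>R g x \<partial>M)"
    if "g \<in> borel_measurable M" "\<And>x. x \<in> space M \<Longrightarrow> norm (g x) \<le> C"
    for g :: "'a \<Rightarrow> 'w :: euclidean_space" and C
    by (rule tendsto_integral_L1[OF _ p L1p that]) (use ds in auto)
  have one: "(\<integral>x. p x \<partial>M) = 1"
  proof -
    have "(\<lambda>n. \<integral>x. s n x \<partial>M) \<longlonglongrightarrow> (\<integral>x. p x \<partial>M)"
      using lim[of "\<lambda>_. 1::real" 1] by simp
    then show ?thesis using ds by (simp add: LIMSEQ_const_iff)
  qed
  have limf: "(\<lambda>n. \<integral>x. s n x * f x \<partial>M) \<longlonglongrightarrow> (\<integral>x. p x * f x \<partial>M)"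
    using lim[of f B] f_bound by simp
  define e where "e n = ((\<integral>x. s n x * f x \<partial>M) - c n) / \<epsilon>" for n
  define e0 where "e0 = ((\<integral>x. p x * f x \<partial>M) - c0) / \<epsilon>"
  have e: "e \<longlonglongrightarrow> e0"
    unfolding e_def[abs_def] e0_def using eps_pos by (intro tendsto_intros limf obj(2)) auto
  have ent: "(\<integral>x. s n x * ln (s n x) \<partial>M) \<le> e n" for n
    using obj(1)[of n] eps_pos by (simp add: e_def objective_def field_simps)
  have nn: "(\<integral>\<^sup>+x. ennreal (p x * ln (p x) + 1) \<partial>M) \<le> ennreal (e0 + 1)"
  proof -
    have "(\<integral>\<^sup>+x. ennreal (p x * ln (p x) + 1) \<partial>M)
        = (\<integral>\<^sup>+x. liminf (\<lambda>n. ennreal (s n x * ln (s n x) + 1)) \<partial>M)"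
    proof (rule nn_integral_cong_AE, use ae pq in eventually_elim)
      case (elim x)
      then have "(\<lambda>n. s n x) \<longlonglongrightarrow> p x" by simp
      moreover have "isCont (\<lambda>x. x * ln x) (p x)" by (rule isCont_mult_ln) (simp add: p_def)
      ultimately have "(\<lambda>n. s n x * ln (s n x)) \<longlonglongrightarrow> p x * ln (p x)"
        by (rule isCont_tendsto_compose[rotated])
      then have "(\<lambda>n. ennreal (s n x * ln (s n x) + 1)) \<longlonglongrightarrow> ennreal (p x * ln (p x) + 1)"
        by (intro tendsto_ennrealI tendsto_add tendsto_const)
      then show ?case by (intro lim_imp_Liminf[symmetric]) auto
    qed
    also have "\<dots> \<le> liminf (\<lambda>n. \<integral>\<^sup>+x. ennreal (s n x * ln (s n x) + 1) \<partial>M)"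
      by (rule nn_integral_liminf) simp
    also have "\<dots> \<le> liminf (\<lambda>n. ennreal (e n + 1))"
    proof (rule Liminf_mono, rule always_eventually, rule allI)
      fix n
      have "0 \<le> s n x * ln (s n x) + 1" for x using mult_ln_ge[of "s n x"] ds by simp
      then have "(\<integral>\<^sup>+x. ennreal (s n x * ln (s n x) + 1) \<partial>M) = ennreal (\<integral>x. s n x * ln (s n x) + 1 \<partial>M)"
        using ds by (intro nn_integral_eq_integral) auto
      also have "(\<integral>x. s n x * ln (s n x) + 1 \<partial>M) = (\<integral>x. s n x * ln (s n x) \<partial>M) + 1"
        using ds by (simp add: prob_space)
      also have "ennreal \<dots> \<le> ennreal (e n + 1)" using ent[of n] by (intro ennreal_leI) simp
      finally show "(\<integral>\<^sup>+x. ennreal (s n x * ln (s n x) + 1) \<partial>M) \<le> ennreal (e n + 1)" .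
    qed
    also have "\<dots> = ennreal (e0 + 1)"
      by (intro lim_imp_Liminf tendsto_intros e) auto
    finally show ?thesis .
  qed
  have p0: "0 \<le> p x * ln (p x) + 1" for x using mult_ln_ge[of "p x"] by (simp add: p_def)
  have pm: "(\<lambda>x. p x * ln (p x) + 1) \<in> borel_measurable M" unfolding p_def by measurable
  have i1: "integrable M (\<lambda>x. p x * ln (p x) + 1)"
    by (rule integrableI_nonneg[OF pm]) (use p0 le_less_trans[OF nn ennreal_less_top] in auto)
  from Bochner_Integration.integrable_diff[OF i1, of "\<lambda>_. 1"]
  have i: "integrable M (\<lambda>x. p x * ln (p x))" by simp
  have e0: "0 \<le> e0 + 1"
  proof (rule LIMSEQ_le_const)
    show "(\<lambda>n. e n + 1) \<longlonglongrightarrow> e0 + 1" by (intro tendsto_intros e)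
    have "0 \<le> e n + 1" for n
    proof -
      have "(\<integral>x. - 1 \<partial>M) \<le> (\<integral>x. s n x * ln (s n x) \<partial>M)"
        using ds mult_ln_ge by (intro integral_mono) auto
      then show ?thesis using ent[of n] by (simp add: prob_space)
    qed
    then show "\<exists>N. \<forall>n\<ge>N. 0 \<le> e n + 1" by blast
  qed
  have "ennreal (\<integral>x. p x * ln (p x) + 1 \<partial>M) \<le> ennreal (e0 + 1)"
    using nn nn_integral_eq_integral[OF i1] p0 by simp
  then have "(\<integral>x. p x * ln (p x) + 1 \<partial>M) \<le> e0 + 1"
    using e0 by (subst (asm) ennreal_le_iff) auto
  then have "(\<integral>x. p x * ln (p x) \<partial>M) \<le> e0" using i by (simp add: prob_space)
  then have "c0 \<le> objective p"
    using eps_pos by (simp add: objective_def e0_def field_simps)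
  moreover have "p \<in> entropy_densities M"
    using p one i by (simp add: entropy_densities_def) (simp add: p_def)
  moreover have "(\<lambda>n. moment (s n)) \<longlonglongrightarrow> moment p"
    unfolding moment_def using lim[of h B] h_bound by simp
  ultimately show ?thesis using that by blast
qed

text \<open>This replaces weak compactness of the sublevel sets of the entropy, and with it any constraint
qualification. Let \<open>A n\<close> be the densities with moments within \<open>1 / (n + 1)\<close> of \<open>K\<close>, and choose
\<open>q n\<close> nearly optimal in \<open>A n\<close>. Since \<open>A n\<close> is convex and the optimal values \<open>T n\<close> decrease to a
finite limit, the midpoint of \<open>q n\<close> and \<open>q m\<close> cannot improve much on them; uniform concavity
makes the sequence Cauchy in \<open>L\<^sup>1\<close>, and its limit has moments in \<open>K\<close>.\<close>

lemma approximate_feasibility_imp_feasibility: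
  assumes K: "convex K" "closed K"
    and approx: "\<And>\<delta>. \<delta> > 0 \<Longrightarrow>
      \<exists>q\<in>entropy_densities M. \<exists>k\<in>K. dist k (moment q) < \<delta> \<and> s - \<delta> < objective q"
  shows "\<exists>q\<in>entropy_densities M. moment q \<in> K \<and> s \<le> objective q"
proof -
  define A where "A n = {q \<in> entropy_densities M. \<exists>k\<in>K. dist k (moment q) < 1 / real (Suc n)}" for n
  define T where "T n = (SUP q\<in>A n. objective q)" for n
  have bdd: "bdd_above (objective ` A n)" for n
    by (rule bdd_aboveI2[of _ _ "B + \<epsilon>"]) (auto simp: A_def objective_le)
  have nonempty: "A n \<noteq> {}" for n
    using approx[of "1 / real (Suc n)"] by (auto simp: A_def)
  have A_mono: "A m \<subseteq> A n" if "n \<le> m" for n m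
    using that by (force simp: A_def frac_le intro: less_le_trans)
  have T_anti: "T m \<le> T n" if "n \<le> m" for n m
    unfolding T_def by (rule cSUP_subset_mono[OF nonempty bdd A_mono[OF that]]) simp
  have T_ge: "s \<le> T n" for n
  proof (rule field_le_epsilon)
    fix e :: real assume "e > 0"
    then have "min e (1 / real (Suc n)) > 0" by simp
    from approx[OF this] obtain q k where q: "q \<in> entropy_densities M" "k \<in> K"
      "dist k (moment q) < min e (1 / real (Suc n))" "s - min e (1 / real (Suc n)) < objective q" by blast
    then have "q \<in> A n" by (auto simp: A_def)
    then have "objective q \<le> T n" unfolding T_def by (rule cSUP_upper[OF _ bdd])
    then show "s \<le> T n + e" using q(4) by simp
  qed
  obtain t where t: "T \<longlonglongrightarrow> t" and tT: "\<And>n. t \<le> T n"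
    using decseq_convergent[of T s] T_anti T_ge by (auto simp: decseq_def)
  have "\<exists>q\<in>A n. T n - 1 / real (Suc n) < objective q" for n
    using less_cSUP_iff[OF nonempty bdd, of "T n - 1 / real (Suc n)" n] by (simp add: T_def)
  then obtain q where qA: "\<And>n. q n \<in> A n" and qT: "\<And>n. T n - 1 / real (Suc n) < objective (q n)"
    by metis
  have qD: "q n \<in> entropy_densities M" for n using qA by (auto simp: A_def)
  \<comment> \<open>\<open>\<rho> n\<close> bounds the gain of the midpoint of \<open>q n\<close> and \<open>q m\<close> for every \<open>m \<ge> n\<close>.\<close>
  define \<rho> where "\<rho> n = (T n - t) / 2 + 1 / real (Suc n)" for n
  have "\<rho> \<longlonglongrightarrow> (t - t) / 2 + 0"
    unfolding \<rho>_def[abs_def] by (intro tendsto_intros t LIMSEQ_Suc[OF lim_1_over_n]) auto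
  then have \<rho>: "\<rho> \<longlonglongrightarrow> 0" by simp
  have mid: "objective (\<lambda>x. 1/2 * q n x + 1/2 * q m x) - (objective (q n) + objective (q m)) / 2 \<le> \<rho> n"
    if "n \<le> m" for n m
  proof -
    let ?w = "\<lambda>x. 1/2 * q n x + 1/2 * q m x"
    obtain k where k: "k \<in> K" "dist k (moment (q n)) < 1 / real (Suc n)" using qA[of n] by (auto simp: A_def)
    obtain l where l: "l \<in> K" "dist l (moment (q m)) < 1 / real (Suc n)"
      using qA[of m] A_mono[OF \<open>n \<le> m\<close>] by (auto simp: A_def)
    have "?w \<in> entropy_densities M" by (rule mixture_density[OF qD qD]) auto
    moreover have "(1/2) *\<^sub>R k + (1/2) *\<^sub>R l \<in> K" using k l K by (intro convexD) auto
    moreover have "dist ((1/2) *\<^sub>R k + (1/2) *\<^sub>R l) (moment ?w) < 1 / real (Suc n)"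
    proof -
      have m: "moment ?w = (1/2) *\<^sub>R moment (q n) + (1/2) *\<^sub>R moment (q m)"
        by (rule moment_mixture[OF qD qD]) auto
      have "dist ((1/2) *\<^sub>R k + (1/2) *\<^sub>R l) (moment ?w)
          = norm ((1/2) *\<^sub>R (k - moment (q n)) + (1/2) *\<^sub>R (l - moment (q m)))"
        unfolding m dist_norm by (simp add: algebra_simps)
      also have "\<dots> \<le> 1/2 * norm (k - moment (q n)) + 1/2 * norm (l - moment (q m))"
        by (rule order.trans[OF norm_triangle_ineq]) simp
      also have "\<dots> < 1 / real (Suc n)" using k l by (simp add: dist_norm)
      finally show ?thesis .
    qed
    ultimately have "?w \<in> A n" by (auto simp: A_def)
    then have "objective ?w \<le> T n" unfolding T_def by (rule cSUP_upper[OF _ bdd])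
    moreover have "t - 1 / real (Suc n) < objective (q m)"
    proof -
      have "1 / real (Suc m) \<le> 1 / real (Suc n)" using that by (simp add: frac_le)
      then show ?thesis using qT[of m] tT[of m] by linarith
    qed
    ultimately show ?thesis using qT[of n] unfolding \<rho>_def by argo
  qed
  have Cauchy: "\<exists>N. \<forall>i\<ge>N. \<forall>j\<ge>N. (\<integral>x. \<bar>q i x - q j x\<bar> \<partial>M) < e" if "e > 0" for e
  proof -
    define \<theta> where "\<theta> = e / 4"
    have \<theta>: "\<theta> > 0" using that by (simp add: \<theta>_def)
    have "(\<lambda>n. 2 / (\<theta> * \<epsilon>) * \<rho> n) \<longlonglongrightarrow> 2 / (\<theta> * \<epsilon>) * 0" by (intro tendsto_intros \<rho>)
    then have "\<forall>\<^sub>F n in sequentially. 2 / (\<theta> * \<epsilon>) * \<rho> n < e / 2"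
      using that by (intro order_tendstoD) auto
    then obtain N where N: "\<And>n. n \<ge> N \<Longrightarrow> 2 / (\<theta> * \<epsilon>) * \<rho> n < e / 2"
      by (auto simp: eventually_sequentially)
    have le: "(\<integral>x. \<bar>q i x - q j x\<bar> \<partial>M) < e" if "N \<le> i" "i \<le> j" for i j
    proof -
      have "(\<integral>x. \<bar>q i x - q j x\<bar> \<partial>M) \<le> 2 * \<theta> + 2 / (\<theta> * \<epsilon>) *
          (objective (\<lambda>x. 1/2 * q i x + 1/2 * q j x) - (objective (q i) + objective (q j)) / 2)"
        by (rule L1_dist_le_objective_gap[OF qD qD \<theta>])
      also have "\<dots> \<le> 2 * \<theta> + 2 / (\<theta> * \<epsilon>) * \<rho> i"
        using mid[OF \<open>i \<le> j\<close>] \<theta> eps_pos by (intro add_left_mono mult_left_mono) auto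
      also have "\<dots> < e" using N[OF \<open>N \<le> i\<close>] by (simp add: \<theta>_def)
      finally show ?thesis .
    qed
    have "(\<integral>x. \<bar>q i x - q j x\<bar> \<partial>M) < e" if "N \<le> i" "N \<le> j" for i j
      using le[of i j] le[of j i] that by (cases "i \<le> j") (auto simp: abs_minus_commute)
    then show ?thesis by blast
  qed
  obtain r q0 where r: "strict_mono r" and q0: "integrable M q0"
    and ae: "AE x in M. (\<lambda>i. q (r i) x) \<longlonglongrightarrow> q0 x"
    and L1: "(\<lambda>i. \<integral>x. \<bar>q (r i) x - q0 x\<bar> \<partial>M) \<longlonglongrightarrow> 0"
    using L1_Cauchy_convergent_subseq[of M q, OF _ Cauchy] qD
    by (auto simp: entropy_densities_def)
  have inv: "(\<lambda>i. 1 / real (Suc (r i))) \<longlonglongrightarrow> 0"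
    using LIMSEQ_subseq_LIMSEQ[OF LIMSEQ_Suc[OF lim_1_over_n] r] by (simp add: comp_def)
  have "(\<lambda>i. s - 1 / real (Suc (r i))) \<longlonglongrightarrow> s - 0" by (intro tendsto_intros inv)
  then have cl: "(\<lambda>i. s - 1 / real (Suc (r i))) \<longlonglongrightarrow> s" by simp
  have c: "s - 1 / real (Suc (r i)) \<le> objective (q (r i))" for i
    using qT[of "r i"] T_ge[of "r i"] by linarith
  obtain p where p: "p \<in> entropy_densities M" "s \<le> objective p"
    and m: "(\<lambda>i. moment (q (r i))) \<longlonglongrightarrow> moment p"
    using density_limit[OF qD q0 ae L1 c cl] by metis
  have "\<exists>k\<in>K. dist k (moment (q (r i))) < 1 / real (Suc (r i))" for i
    using qA[of "r i"] by (auto simp: A_def)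
  then obtain k where k: "\<And>i. k i \<in> K" "\<And>i. dist (k i) (moment (q (r i))) < 1 / real (Suc (r i))"
    by metis
  have "(\<lambda>i. dist (k i) (moment (q (r i)))) \<longlonglongrightarrow> 0"
    by (rule tendsto_sandwich[OF _ _ tendsto_const inv]) (use less_imp_le[OF k(2)] in auto)
  from Lim_transform[OF m this[unfolded dist_norm tendsto_norm_zero_iff]]
  have "k \<longlonglongrightarrow> moment p" by simp
  then have "moment p \<in> K" using closed_sequentially[OF K(2)] k(1) by blast
  then show ?thesis using p by blast
qed

section \<open>Gibbs densities and separation\<close>

text \<open>The convex conjugate of the entropy term: the optimal unconstrained value when the payoff is
\<open>f\<close> tilted by the linear functional \<open>w\<close> of the moments.\<close>

definition log_partition :: "'v \<Rightarrow> real"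
  where "log_partition w = \<epsilon> * ln (\<integral>x. exp ((f x + w \<bullet> h x) / \<epsilon>) \<partial>M)"

lemma tilt_bound: "\<bar>f x + w \<bullet> h x\<bar> \<le> B + norm w * B" if "x \<in> space M"
proof -
  have "\<bar>w \<bullet> h x\<bar> \<le> norm w * norm (h x)" by (rule Cauchy_Schwarz_ineq2)
  also have "\<dots> \<le> norm w * B" using h_bound[OF that] by (intro mult_left_mono) auto
  finally show ?thesis using f_bound[OF that] by linarith
qed

lemma partition_integrable: "integrable M (\<lambda>x. exp ((f x + w \<bullet> h x) / \<epsilon>))"
proof (rule integrable_const_bound)
  show "AE x in M. norm (exp ((f x + w \<bullet> h x) / \<epsilon>)) \<le> exp ((B + norm w * B) / \<epsilon>)"
  proof (rule AE_I2)
    fix x assume "x \<in> space M"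
    then show "norm (exp ((f x + w \<bullet> h x) / \<epsilon>)) \<le> exp ((B + norm w * B) / \<epsilon>)"
      using tilt_bound[of x w] eps_pos by (simp add: divide_right_mono)
  qed
qed measurable

lemma partition_pos: "0 < (\<integral>x. exp ((f x + w \<bullet> h x) / \<epsilon>) \<partial>M)"
proof -
  have "(\<integral>x. exp (- (B + norm w * B) / \<epsilon>) \<partial>M) \<le> (\<integral>x. exp ((f x + w \<bullet> h x) / \<epsilon>) \<partial>M)"
  proof (rule integral_mono[OF _ partition_integrable])
    fix x assume "x \<in> space M"
    then show "exp (- (B + norm w * B) / \<epsilon>) \<le> exp ((f x + w \<bullet> h x) / \<epsilon>)"
      using tilt_bound[of x w] eps_pos by (auto intro!: divide_right_mono)
  qed simp
  then show ?thesis by (rule less_le_trans[rotated]) (simp add: prob_space)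
qed

lemma objective_plus_linear:
  assumes q: "q \<in> entropy_densities M"
  shows "integrable M (\<lambda>x. q x * (f x + w \<bullet> h x))"
    and "objective q + w \<bullet> moment q
      = (\<integral>x. q x * (f x + w \<bullet> h x) \<partial>M) - \<epsilon> * (\<integral>x. q x * ln (q x) \<partial>M)"
proof -
  have e: "(\<lambda>x. q x * (f x + w \<bullet> h x)) = (\<lambda>x. q x * f x + w \<bullet> (q x *\<^sub>R h x))"
    by (simp add: fun_eq_iff algebra_simps)
  note i = integrable_density_f[OF q] integrable_inner_right[OF integrable_density_h[OF q], of w]
  show "integrable M (\<lambda>x. q x * (f x + w \<bullet> h x))"
    unfolding e using i by (intro Bochner_Integration.integrable_add) auto
  have "w \<bullet> moment q = (\<integral>x. w \<bullet> (q x *\<^sub>R h x) \<partial>M)"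
    unfolding moment_def using integrable_density_h[OF q] by (intro integral_inner_right[symmetric]) simp
  then show "objective q + w \<bullet> moment q
      = (\<integral>x. q x * (f x + w \<bullet> h x) \<partial>M) - \<epsilon> * (\<integral>x. q x * ln (q x) \<partial>M)"
    unfolding e objective_def Bochner_Integration.integral_add[OF i] by simp
qed

text \<open>Integrate the tangent inequality for \<open>x ln x\<close> whose contact point is the Gibbs density
\<open>exp (g / \<epsilon>) / Z\<close> of the tilted payoff \<open>g\<close>.\<close>

lemma Gibbs_inequality:
  assumes q: "q \<in> entropy_densities M"
  shows "objective q + w \<bullet> moment q \<le> log_partition w"
proof -
  note d = q[unfolded entropy_densities_def, simplified]
  define g where "g x = f x + w \<bullet> h x" for x
  define Z where "Z = (\<integral>x. exp (g x / \<epsilon>) \<partial>M)"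
  have Z: "Z > 0" using partition_pos by (simp add: Z_def g_def)
  have ig: "integrable M (\<lambda>x. q x * g x)" using objective_plus_linear(1)[OF q] by (simp add: g_def)
  have iZ: "integrable M (\<lambda>x. exp (g x / \<epsilon>))" using partition_integrable by (simp add: g_def)
  have pointwise: "q x * g x / \<epsilon> - ln Z * q x + q x - exp (g x / \<epsilon>) / Z \<le> q x * ln (q x)" for x
    using mult_ln_tangent[of "q x" "exp (g x / \<epsilon>) / Z"] d Z by (simp add: ln_div algebra_simps)
  have "(\<integral>x. q x * g x / \<epsilon> - ln Z * q x + q x - exp (g x / \<epsilon>) / Z \<partial>M) \<le> (\<integral>x. q x * ln (q x) \<partial>M)"
    using ig iZ d pointwise by (intro integral_mono) auto
  moreover have "(\<integral>x. q x * g x / \<epsilon> - ln Z * q x + q x - exp (g x / \<epsilon>) / Z \<partial>M)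
      = (\<integral>x. q x * g x \<partial>M) / \<epsilon> - ln Z"
    using ig iZ d Z by (simp add: Z_def[symmetric])
  ultimately have "(\<integral>x. q x * g x \<partial>M) - \<epsilon> * (\<integral>x. q x * ln (q x) \<partial>M) \<le> \<epsilon> * ln Z"
    using eps_pos by (simp add: field_simps)
  then show ?thesis
    by (simp add: objective_plus_linear(2)[OF q] log_partition_def Z_def g_def)
qed

lemma Gibbs_density_attains:
  "\<exists>q\<in>entropy_densities M. objective q + w \<bullet> moment q = log_partition w"
proof -
  define g where "g x = f x + w \<bullet> h x" for x
  define Z where "Z = (\<integral>x. exp (g x / \<epsilon>) \<partial>M)"
  have Z: "Z > 0" using partition_pos by (simp add: Z_def g_def)
  have [measurable]: "g \<in> borel_measurable M" unfolding g_def by measurable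
  have iZ: "integrable M (\<lambda>x. exp (g x / \<epsilon>))" using partition_integrable by (simp add: g_def)
  define q where "q x = exp (g x / \<epsilon>) / Z" for x
  have iq: "integrable M q" unfolding q_def using iZ by simp
  have one: "(\<integral>x. q x \<partial>M) = 1" using Z by (simp add: q_def Z_def[symmetric])
  have ig: "integrable M (\<lambda>x. q x * g x)"
    using integrable_scaleR_bounded[OF iq, of g "B + norm w * B"] tilt_bound by (simp add: g_def)
  have ent: "q x * ln (q x) = q x * g x / \<epsilon> - ln Z * q x" for x
  proof -
    have ln_q: "ln (q x) = g x / \<epsilon> - ln Z" using Z by (simp add: q_def ln_div)
    show ?thesis unfolding ln_q by (simp add: right_diff_distrib)
  qed
  have ie: "integrable M (\<lambda>x. q x * ln (q x))" unfolding ent using ig iq by auto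
  have q: "q \<in> entropy_densities M"
    using iq one ie Z by (simp add: entropy_densities_def) (simp add: q_def)
  have "(\<integral>x. q x * ln (q x) \<partial>M) = (\<integral>x. q x * g x \<partial>M) / \<epsilon> - ln Z"
    unfolding ent using ig iq one by simp
  then have "objective q + w \<bullet> moment q = log_partition w"
    using eps_pos objective_plus_linear(2)[OF q, of w]
    by (simp add: log_partition_def Z_def g_def field_simps)
  then show ?thesis using q by blast
qed

text \<open>The set \<open>E\<close> of pairs (constraint violation, missing value) is convex, and
\<open>approximate_feasibility_imp_feasibility\<close> keeps the origin out of its closure. A separating functional
\<open>(a, c)\<close> has \<open>c \<ge> 0\<close>. If \<open>c > 0\<close>, then \<open>a / c\<close> is the multiplier. If \<open>c = 0\<close>, the
functional \<open>a\<close> separates the attainable moments from \<open>K\<close> by a positive margin \<open>b\<close>; the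
multiplier \<open>N a\<close> then has dual value at most \<open>B + \<epsilon> - N b\<close>, which is below \<open>s\<close> for large \<open>N\<close>.\<close>

theorem dual_certificate:
  assumes K: "convex K" "closed K" "K \<noteq> {}"
    and infeasible: "\<And>q. q \<in> entropy_densities M \<Longrightarrow> moment q \<in> K \<Longrightarrow> objective q < s"
  shows "\<exists>w. \<forall>k\<in>K. log_partition w - w \<bullet> k \<le> s"
proof -
  define E where "E = {(k - moment q, t - objective q) | k q t.
    k \<in> K \<and> q \<in> entropy_densities M \<and> s \<le> t}"
  have "convex E"
  proof (rule convexI)
    fix x y u v assume xy: "x \<in> E" "y \<in> E" and uv: "0 \<le> (u::real)" "0 \<le> v" "u + v = 1"
    obtain k q t where x: "x = (k - moment q, t - objective q)" "k \<in> K" "q \<in> entropy_densities M" "s \<le> t"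
      using xy(1) by (auto simp: E_def)
    obtain l p r where y: "y = (l - moment p, r - objective p)" "l \<in> K" "p \<in> entropy_densities M" "s \<le> r"
      using xy(2) by (auto simp: E_def)
    define w where "w = (\<lambda>x. u * q x + v * p x)"
    define \<tau> where "\<tau> = u * t + v * r + (objective w - (u * objective q + v * objective p))"
    have w: "w \<in> entropy_densities M" "moment w = u *\<^sub>R moment q + v *\<^sub>R moment p"
        "u * objective q + v * objective p \<le> objective w"
      unfolding w_def using mixture_density moment_mixture objective_mixture_ge x y uv by blast+
    have "u * s + v * s \<le> u * t + v * r" using x y uv by (intro add_mono mult_left_mono)
    moreover have "u * s + v * s = s" using uv by (simp flip: distrib_right)
    ultimately have "s \<le> \<tau>" using w(3) by (simp add: \<tau>_def)
    moreover have "u *\<^sub>R k + v *\<^sub>R l \<in> K" using K x y uv by (intro convexD) auto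
    moreover have "u *\<^sub>R x + v *\<^sub>R y = (u *\<^sub>R k + v *\<^sub>R l - moment w, \<tau> - objective w)"
      by (simp add: x y w \<tau>_def algebra_simps)
    ultimately show "u *\<^sub>R x + v *\<^sub>R y \<in> E" unfolding E_def using w(1) by blast
  qed
  moreover have "0 \<notin> closure E"
  proof
    assume "0 \<in> closure E"
    have "\<exists>q\<in>entropy_densities M. \<exists>k\<in>K. dist k (moment q) < \<delta> \<and> s - \<delta> < objective q"
      if "\<delta> > 0" for \<delta>
    proof -
      obtain z where "z \<in> E" and z: "dist z 0 < \<delta>"
        using \<open>0 \<in> closure E\<close> \<open>\<delta> > 0\<close> unfolding closure_approachable by blast
      then obtain k q t where E: "z = (k - moment q, t - objective q)" "k \<in> K"
        "q \<in> entropy_densities M" "s \<le> t" by (auto simp: E_def)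
      have "norm (k - moment q) < \<delta>" "\<bar>t - objective q\<bar> < \<delta>"
        using z norm_fst_le[of "k - moment q" "t - objective q"] norm_snd_le[of "t - objective q" "k - moment q"]
        by (auto simp: E)
      then have "dist k (moment q) < \<delta>" "s - \<delta> < objective q" using E by (auto simp: dist_norm)
      then show ?thesis using E by blast
    qed
    from approximate_feasibility_imp_feasibility[OF K(1,2) this] infeasible
    show False by force
  qed
  ultimately obtain z b where z: "z \<bullet> 0 < b" "\<And>x. x \<in> closure E \<Longrightarrow> b < z \<bullet> x"
    using separating_hyperplane_closed_point[of "closure E" 0] by (auto simp: convex_closure)
  obtain a c where ac: "z = (a, c)" by (cases z)
  have b: "b > 0" using z by simp
  have sep: "b < a \<bullet> (k - moment q) + c * (t - objective q)"
    if "k \<in> K" "q \<in> entropy_densities M" "s \<le> t" for k q t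
    using z(2)[of "(k - moment q, t - objective q)"] that closure_subset[of E]
    by (auto simp: E_def ac)
  obtain k0 where k0: "k0 \<in> K" using K by blast
  obtain q0 where q0: "q0 \<in> entropy_densities M" using Gibbs_density_attains by blast
  have "c \<ge> 0"
  proof (rule ccontr)
    assume "\<not> c \<ge> 0"
    then have c: "c < 0" by simp
    \<comment> \<open>A level \<open>t\<close> so high that a negative \<open>c\<close> outweighs the moment part of the functional.\<close>
    define t where "t = max s (objective q0 + \<bar>a \<bullet> (k0 - moment q0)\<bar> / (- c))"
    have "\<bar>a \<bullet> (k0 - moment q0)\<bar> / (- c) \<le> t - objective q0" by (simp add: t_def)
    then have "\<bar>a \<bullet> (k0 - moment q0)\<bar> \<le> (- c) * (t - objective q0)"
      using c by (simp only: pos_divide_le_eq mult.commute)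
    then have "a \<bullet> (k0 - moment q0) + c * (t - objective q0) \<le> 0" by linarith
    then show False using sep[OF k0 q0, of t] b by (simp add: t_def)
  qed
  then consider "c > 0" | "c = 0" by fastforce
  then show ?thesis
  proof cases
    case 1
    have "log_partition (a /\<^sub>R c) - (a /\<^sub>R c) \<bullet> k \<le> s" if k: "k \<in> K" for k
    proof -
      obtain q where q: "q \<in> entropy_densities M"
        "objective q + (a /\<^sub>R c) \<bullet> moment q = log_partition (a /\<^sub>R c)"
        using Gibbs_density_attains by blast
      have "0 < a \<bullet> (k - moment q) + c * (s - objective q)" using sep[OF k q(1), of s] b by simp
      then have "0 < (a \<bullet> (k - moment q) + c * (s - objective q)) / c" using 1 by simp
      also have "\<dots> = (a /\<^sub>R c) \<bullet> k - (a /\<^sub>R c) \<bullet> moment q + s - objective q"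
        using 1 by (simp add: field_simps inner_diff_right)
      finally show ?thesis using q(2) by linarith
    qed
    then show ?thesis by blast
  next
    case 2
    \<comment> \<open>Chosen so that \<open>B + \<epsilon> - N b \<le> s\<close>, where \<open>B + \<epsilon>\<close> bounds the objective.\<close>
    define N where "N = max 0 ((B + \<epsilon> - s) / b)"
    have N: "0 \<le> N" "B + \<epsilon> - s \<le> N * b"
      using b by (auto simp: N_def pos_divide_le_eq[symmetric])
    have "log_partition (N *\<^sub>R a) - (N *\<^sub>R a) \<bullet> k \<le> s" if k: "k \<in> K" for k
    proof -
      obtain q where q: "q \<in> entropy_densities M"
        "objective q + (N *\<^sub>R a) \<bullet> moment q = log_partition (N *\<^sub>R a)"
        using Gibbs_density_attains by blast
      have "b \<le> a \<bullet> (k - moment q)" using sep[OF k q(1), of s] 2 by simp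
      then have "N * b \<le> N * (a \<bullet> (k - moment q))" using N by (intro mult_left_mono)
      then have "N * b \<le> (N *\<^sub>R a) \<bullet> k - (N *\<^sub>R a) \<bullet> moment q"
        by (simp add: inner_diff_right right_diff_distrib)
      then show ?thesis using q(2) objective_le[OF q(1)] N by linarith
    qed
    then show ?thesis by blast
  qed
qed

end

section \<open>Relative entropy and the truncated Gaussian law\<close>

lemma ereal_integral_eq_integral:
  assumes "integrable M g"
  shows "ereal_integral M g = ereal (\<integral>x. g x \<partial>M)"
proof -
  obtain r q where "0 \<le> r" "0 \<le> q" "(\<integral>\<^sup>+x. ennreal (g x) \<partial>M) = ennreal r"
    "(\<integral>\<^sup>+x. ennreal (- g x) \<partial>M) = ennreal q" "integral\<^sup>L M g = r - q"
    using assms by (rule integrableE)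
  then show ?thesis by (simp add: ereal_integral_def)
qed

text \<open>The change of variables from \<open>Q\<close> to \<open>M\<close> is done for the positive and the negative part of the
log-density at once, through a factor \<open>c = 1\<close> or \<open>c = -1\<close>, so it also covers infinite entropy.\<close>

lemma (in prob_space) rel_entropy_density_eq:
  assumes q [measurable]: "q \<in> borel_measurable M" and q0: "\<And>x. 0 \<le> q x"
  shows "rel_entropy M (density M (\<lambda>x. ennreal (q x))) = ereal_integral M (\<lambda>x. q x * ln (q x))"
proof -
  let ?Q = "density M (\<lambda>x. ennreal (q x))"
  let ?L = "\<lambda>x. ln (enn2real (RN_deriv M ?Q x))"
  have "AE x in M. ennreal (q x) = RN_deriv M ?Q x" by (rule RN_deriv_unique) auto
  then have L: "AE x in M. ?L x = ln (q x)"
  proof eventually_elim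
    case (elim x)
    show ?case unfolding elim[symmetric] using q0[of x] by simp
  qed
  have "(\<integral>\<^sup>+x. ennreal (c * ?L x) \<partial>?Q) = (\<integral>\<^sup>+x. ennreal (c * (q x * ln (q x))) \<partial>M)" for c :: real
  proof -
    have "(\<integral>\<^sup>+x. ennreal (c * ?L x) \<partial>?Q) = (\<integral>\<^sup>+x. ennreal (q x) * ennreal (c * ?L x) \<partial>M)"
      by (intro nn_integral_density) measurable
    also have "\<dots> = (\<integral>\<^sup>+x. ennreal (c * (q x * ln (q x))) \<partial>M)"
    proof (rule nn_integral_cong_AE, use L in eventually_elim)
      case (elim x)
      show ?case unfolding elim using q0[of x] by (simp add: ennreal_mult'[symmetric] mult_ac)
    qed
    finally show ?thesis .
  qed
  from this[of 1] this[of "- 1"] have "ereal_integral ?Q ?L = ereal_integral M (\<lambda>x. q x * ln (q x))"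
    by (simp add: ereal_integral_def)
  moreover have "absolutely_continuous M ?Q" by (rule absolutely_continuousI_density) simp
  ultimately show ?thesis by (simp add: rel_entropy_def)
qed

lemma (in prob_space) rel_entropy_entropy_density:
  assumes "q \<in> entropy_densities M"
  shows "rel_entropy M (density M (\<lambda>x. ennreal (q x))) = ereal (\<integral>x. q x * ln (q x) \<partial>M)"
  using assms by (subst rel_entropy_density_eq)
    (auto simp: entropy_densities_def intro: ereal_integral_eq_integral)

text \<open>The negative part of \<open>q ln q\<close> is bounded by \<open>1\<close>, so a finite entropy leaves an integrable positive
part.\<close>

lemma (in prob_space) finite_rel_entropy_imp_density:
  assumes Q: "prob_space Q" "sets Q = sets M" and fin: "rel_entropy M Q \<noteq> \<infinity>"
  shows "\<exists>q\<in>entropy_densities M. Q = density M (\<lambda>x. ennreal (q x))"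
proof -
  interpret Q: prob_space Q by (rule Q)
  have ac: "absolutely_continuous M Q" using fin by (simp add: rel_entropy_def split: if_splits)
  define q where "q x = enn2real (RN_deriv M Q x)" for x
  have [measurable]: "q \<in> borel_measurable M" unfolding q_def by measurable
  have q0: "0 \<le> q x" for x by (simp add: q_def)
  have "AE x in M. RN_deriv M Q x \<noteq> \<infinity>"
    by (rule RN_deriv_finite[OF _ ac Q(2)]) (rule Q.sigma_finite_measure_axioms)
  then have "AE x in M. RN_deriv M Q x = ennreal (q x)"
    by eventually_elim (simp add: q_def less_top)
  then have "density M (RN_deriv M Q) = density M (\<lambda>x. ennreal (q x))"
    by (intro density_cong) auto
  then have Qq: "Q = density M (\<lambda>x. ennreal (q x))"
    using density_RN_deriv[OF ac Q(2)] by simp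
  have "(\<integral>\<^sup>+x. ennreal (q x) \<partial>M) = emeasure Q (space Q)"
    by (subst (1 2) Qq) (simp add: emeasure_density cong: nn_integral_cong)
  then have nn: "(\<integral>\<^sup>+x. ennreal (q x) \<partial>M) = 1" by (simp add: Q.emeasure_space_1)
  have iq: "integrable M q" by (rule integrableI_nonneg) (use nn q0 in auto)
  have one: "(\<integral>x. q x \<partial>M) = 1"
    using nn_integral_eq_integral[OF iq] q0 nn by simp
  have "(\<integral>\<^sup>+x. ennreal (- (q x * ln (q x))) \<partial>M) \<le> (\<integral>\<^sup>+x. 1 \<partial>M)"
  proof (rule nn_integral_mono)
    fix x show "ennreal (- (q x * ln (q x))) \<le> 1"
      using mult_ln_ge[OF q0[of x]] by (intro ennreal_le_1[THEN iffD2]) linarith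
  qed
  then have neg: "(\<integral>\<^sup>+x. ennreal (- (q x * ln (q x))) \<partial>M) \<noteq> \<infinity>"
    by (auto simp: emeasure_space_1 top_unique)
  have "ereal_integral M (\<lambda>x. q x * ln (q x)) \<noteq> \<infinity>"
    using fin rel_entropy_density_eq[of q] q0 Qq by simp
  then have pos: "(\<integral>\<^sup>+x. ennreal (q x * ln (q x)) \<partial>M) \<noteq> \<infinity>"
    using neg unfolding ereal_integral_def
    by (cases "\<integral>\<^sup>+x. ennreal (- (q x * ln (q x))) \<partial>M") (auto simp: enn2ereal_ennreal)
  have "integrable M (\<lambda>x. q x * ln (q x))"
    unfolding real_integrable_def using pos neg by simp
  then show ?thesis using Qq iq one q0 by (auto simp: entropy_densities_def)
qed

lemma continuous_gaussian_weight: "continuous_on A (gaussian_weight \<mu> \<Sigma>)"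
  unfolding gaussian_weight_def
  by (intro continuous_intros linear_continuous_on_compose[OF _ matrix_vector_mul_linear])

lemma
  fixes \<Xi> :: "(real ^ 'k) set"
  assumes "compact \<Xi>" and pos: "emeasure lborel \<Xi> > 0"
  shows prob_space_truncated_gaussian: "prob_space (truncated_gaussian \<Xi> \<mu> \<Sigma>)"
    and sets_truncated_gaussian: "sets (truncated_gaussian \<Xi> \<mu> \<Sigma>) = sets (restrict_space borel \<Xi>)"
proof -
  let ?L = "restrict_space lborel \<Xi>" and ?g = "gaussian_weight \<mu> \<Sigma>"
  have \<Xi>: "\<Xi> \<in> sets borel" using assms(1) by (simp add: borel_closed compact_imp_closed)
  have setsL: "sets ?L = sets (restrict_space borel \<Xi>)" by (rule sets_restrict_space_cong) simp
  have spaceL: "space ?L = \<Xi>" by (simp add: space_restrict_space)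
  show "sets (truncated_gaussian \<Xi> \<mu> \<Sigma>) = sets (restrict_space borel \<Xi>)"
    by (simp add: truncated_gaussian_def Let_def setsL)
  have g0: "0 < ?g x" for x by (simp add: gaussian_weight_def)
  have "?g \<in> borel_measurable borel"
    using borel_measurable_continuous_onI[OF continuous_gaussian_weight] .
  then have g [measurable]: "?g \<in> borel_measurable ?L"
    by (intro measurable_restrict_space1) simp
  have fin: "emeasure ?L \<Xi> < \<infinity>"
    using emeasure_compact_finite[OF assms(1)] \<Xi> by (simp add: emeasure_restrict_space)
  obtain C where C: "\<And>x. x \<in> \<Xi> \<Longrightarrow> norm (?g x) \<le> C"
    using compact_imp_bounded[OF compact_continuous_image[OF continuous_gaussian_weight assms(1)]]
    unfolding bounded_iff by blast
  have int: "integrable ?L ?g"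
  proof (rule integrableI_bounded_set[of \<Xi> _ _ C])
    show "\<Xi> \<in> sets ?L" using sets.top[of ?L] by (simp add: spaceL)
  qed (use fin C in \<open>auto simp: spaceL\<close>)
  have I: "0 < (\<integral>x. ?g x \<partial>?L)"
  proof -
    have "(\<integral>x. ?g x \<partial>?L) \<noteq> 0"
    proof
      assume "(\<integral>x. ?g x \<partial>?L) = 0"
      then have "AE x in ?L. ?g x = 0"
        using integral_nonneg_eq_0_iff_AE[OF int] g0 by (auto simp: less_imp_le)
      then have "AE x in ?L. False" by eventually_elim (metis g0 less_irrefl)
      then have "emeasure ?L (space ?L) = 0" by (simp add: AE_iff_null null_sets_def)
      then show False using pos \<Xi> by (simp add: spaceL emeasure_restrict_space)
    qed
    moreover have "0 \<le> (\<integral>x. ?g x \<partial>?L)" using g0 by (intro integral_nonneg_AE) (simp add: less_imp_le)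
    ultimately show ?thesis by simp
  qed
  have "(\<integral>\<^sup>+x. ennreal (1 / (\<integral>x. ?g x \<partial>?L) * ?g x) \<partial>?L) = 1"
  proof -
    have "(\<integral>\<^sup>+x. ennreal (1 / (\<integral>x. ?g x \<partial>?L) * ?g x) \<partial>?L)
        = ennreal (\<integral>x. 1 / (\<integral>x. ?g x \<partial>?L) * ?g x \<partial>?L)"
      using int I g0 by (intro nn_integral_eq_integral) (auto simp: less_imp_le)
    also have "(\<integral>x. 1 / (\<integral>x. ?g x \<partial>?L) * ?g x \<partial>?L) = 1" using I by simp
    finally show ?thesis by simp
  qed
  then show "prob_space (truncated_gaussian \<Xi> \<mu> \<Sigma>)"
    unfolding truncated_gaussian_def Let_def
    by (intro prob_spaceI) (simp add: emeasure_density cong: nn_integral_cong)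
qed

section \<open>Positive semi-definite matrices\<close>

lemma frobenius_eq_inner: "A :\<^sub>F B = A \<bullet> B"
proof -
  have "A :\<^sub>F B = (\<Sum>i\<in>UNIV. \<Sum>k\<in>UNIV. A $ k $ i * B $ k $ i)"
    by (simp add: frobenius_def trace_def matrix_matrix_mult_def transpose_def)
  also have "\<dots> = (\<Sum>k\<in>UNIV. \<Sum>i\<in>UNIV. A $ k $ i * B $ k $ i)" by (rule sum.swap)
  finally show ?thesis by (simp add: inner_vec_def)
qed

lemma symmetric_iff: "transpose A = A \<longleftrightarrow> (\<forall>i j. A $ i $ j = A $ j $ i)"
  unfolding vec_eq_iff[of "transpose A"] vec_eq_iff[of "transpose A $ _"]
  by (simp add: transpose_def eq_commute)

lemma inner_symmetric_matrix: "x \<bullet> (A *v y) = y \<bullet> (A *v x)" if "transpose A = A" for A :: "real ^ 'k ^ 'k"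
  by (metis that dot_lmul_matrix inner_commute transpose_matrix_vector)

lemma transpose_outer: "transpose (v \<otimes>\<^sub>v v) = v \<otimes>\<^sub>v v"
  by (simp add: transpose_def outer_def mult.commute)

lemma inner_outer: "A \<bullet> (v \<otimes>\<^sub>v v) = v \<bullet> (A *v v)" for A :: "real ^ 'k ^ 'k"
  by (simp add: inner_vec_def outer_def matrix_vector_mult_def sum_distrib_left mult_ac)

lemma outer_quadratic_form: "x \<bullet> ((v \<otimes>\<^sub>v v) *v x) = (v \<bullet> x)\<^sup>2" for v :: "real ^ 'k"
proof -
  have "(v \<otimes>\<^sub>v v) *v x = (v \<bullet> x) *\<^sub>R v"
    by (simp add: vec_eq_iff inner_vec_def outer_def matrix_vector_mult_def sum_distrib_left sum_distrib_right mult_ac)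
  then show ?thesis by (simp add: power2_eq_square inner_commute)
qed

lemma outer_psd: "v \<otimes>\<^sub>v v \<in> psd_matrices"
  by (simp add: psd_matrices_def transpose_outer outer_quadratic_form)

lemma transpose_linear:
  fixes A B :: "real ^ 'k ^ 'm"
  shows "transpose (A + B) = transpose A + transpose B" "transpose (A - B) = transpose A - transpose B"
    "transpose (c *\<^sub>R A) = c *\<^sub>R transpose A"
  by (simp_all add: transpose_def vec_eq_iff)

lemma psd_matrices_add: "A \<in> psd_matrices \<Longrightarrow> B \<in> psd_matrices \<Longrightarrow> A + B \<in> psd_matrices"
  by (simp add: psd_matrices_def transpose_linear matrix_vector_mult_add_rdistrib inner_add_right)

lemma psd_matrices_scaleR: "A \<in> psd_matrices \<Longrightarrow> 0 \<le> c \<Longrightarrow> c *\<^sub>R A \<in> psd_matrices"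
  by (simp add: psd_matrices_def transpose_linear scaleR_matrix_vector_assoc[symmetric])

lemma psd_matrices_zero: "0 \<in> psd_matrices"
  by (simp add: psd_matrices_def transpose_def vec_eq_iff)

lemma psd_matrices_convex: "convex (psd_matrices :: (real ^ 'k ^ 'k) set)"
  by (intro convexI psd_matrices_add psd_matrices_scaleR)

text \<open>The positive semi-definite matrices form an intersection of hyperplanes (symmetry) and of the
half-spaces whose normals are the rank-one matrices.\<close>

lemma psd_matrices_closed: "closed (psd_matrices :: (real ^ 'k ^ 'k) set)"
proof -
  have e: "(psd_matrices :: (real ^ 'k ^ 'k) set)
      = (\<Inter>i. \<Inter>j. {A. A $ i $ j = A $ j $ i}) \<inter> (\<Inter>x. {A. 0 \<le> A \<bullet> (x \<otimes>\<^sub>v x)})"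
    unfolding inner_outer psd_matrices_def symmetric_iff by blast
  show ?thesis unfolding e
    by (intro closed_Int closed_INT ballI closed_Collect_eq closed_Collect_le continuous_intros)
qed

text \<open>The usual discriminant argument. In the degenerate case \<open>c = 0\<close> the quadratic in \<open>t\<close> is affine and
can only stay nonnegative if its slope vanishes.\<close>

lemma psd_Cauchy_Schwarz:
  fixes S :: "real ^ 'k ^ 'k"
  assumes S: "S \<in> psd_matrices"
  shows "(x \<bullet> (S *v y))\<^sup>2 \<le> (x \<bullet> (S *v x)) * (y \<bullet> (S *v y))"
proof -
  define a where "a = x \<bullet> (S *v x)"
  define b where "b = x \<bullet> (S *v y)"
  define c where "c = y \<bullet> (S *v y)"
  have quad: "0 \<le> a + 2 * t * b + t * t * c" for t
  proof -
    have "y \<bullet> (S *v x) = b" using inner_symmetric_matrix[of S] S by (simp add: psd_matrices_def b_def)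
    then have "(x + t *\<^sub>R y) \<bullet> (S *v (x + t *\<^sub>R y)) = a + 2 * t * b + t * t * c"
      by (simp add: a_def b_def c_def matrix_vector_right_distrib matrix_vector_mult_scaleR
          inner_add_left inner_add_right algebra_simps)
    moreover have "0 \<le> (x + t *\<^sub>R y) \<bullet> (S *v (x + t *\<^sub>R y))"
      using S unfolding psd_matrices_def by blast
    ultimately show ?thesis by simp
  qed
  have "c \<ge> 0" using S by (simp add: psd_matrices_def c_def)
  show ?thesis
  proof (cases "c = 0")
    case True
    have "b = 0"
    proof (rule ccontr)
      assume "b \<noteq> 0"
      then show False using quad[of "- (a + 1) / (2 * b)"] True by (simp add: field_simps)
    qed
    then show ?thesis using True by (simp add: b_def[symmetric] c_def[symmetric])
  next
    case False
    then have c: "c > 0" using \<open>c \<ge> 0\<close> by simp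
    have "0 \<le> a + 2 * (- b / c) * b + (- b / c) * (- b / c) * c" by (rule quad)
    also have "\<dots> = a - b\<^sup>2 / c" using c by (simp add: field_simps power2_eq_square)
    finally have "b\<^sup>2 \<le> a * c" using c by (simp add: field_simps)
    then show ?thesis by (simp add: a_def b_def c_def)
  qed
qed

text \<open>Cholesky elimination makes \<open>S\<close> a sum of rank-one matrices, and the product of \<open>N\<close> with a rank-one
matrix is a value of the quadratic form of \<open>N\<close>. A step subtracts \<open>(v \<otimes>\<^sub>v v) / S\<^sub>i\<^sub>i\<close>, where \<open>v\<close> is a
row with a positive diagonal entry: by the Cauchy-Schwarz inequality the difference is still
positive semi-definite, its row \<open>i\<close> vanishes, and rows that were zero stay zero.\<close>

lemma psd_inner_nonneg:
  fixes S N :: "real ^ 'k ^ 'k"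
  assumes "S \<in> psd_matrices" and N: "N \<in> psd_matrices"
  shows "0 \<le> S \<bullet> N"
  using assms(1)
proof (induction "card {i. S $ i \<noteq> 0}" arbitrary: S rule: less_induct)
  case less
  have sym: "S $ i $ j = S $ j $ i" for i j
    using less.prems unfolding psd_matrices_def symmetric_iff by blast
  have col: "x \<bullet> (S *v axis i 1) = (S $ i) \<bullet> x" for x i
    by (simp add: inner_vec_def matrix_vector_mult_basis column_def sym mult.commute)
  have row: "axis j 1 \<bullet> (S *v axis i 1) = S $ j $ i" for i j
    by (simp add: col inner_axis sym)
  have diag: "0 \<le> S $ i $ i" for i
    using less.prems row[of i i] unfolding psd_matrices_def by (metis (mono_tags, lifting) mem_Collect_eq)
  show ?case
  proof (cases "\<forall>i. S $ i $ i = 0")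
    case True
    have "S $ j $ i = 0" for i j
      using psd_Cauchy_Schwarz[OF less.prems, of "axis j 1" "axis i 1"] True by (simp add: row)
    then have "S = 0" by (simp add: vec_eq_iff)
    then show ?thesis by simp
  next
    case False
    then obtain i where i: "S $ i $ i > 0" using diag by (metis less_le)
    define v where "v = S $ i"
    define T where "T = S - (1 / S $ i $ i) *\<^sub>R (v \<otimes>\<^sub>v v)"
    have T_comp: "T $ j $ l = S $ j $ l - S $ i $ j * S $ i $ l / S $ i $ i" for j l
      by (simp add: T_def v_def outer_def)
    have "T \<in> psd_matrices"
    proof -
      have "0 \<le> x \<bullet> (T *v x)" for x
      proof -
        have "(v \<bullet> x)\<^sup>2 \<le> (x \<bullet> (S *v x)) * S $ i $ i"
          using psd_Cauchy_Schwarz[OF less.prems, of x "axis i 1"] by (simp only: row) (simp add: col v_def)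
        then show ?thesis
          using i by (simp add: T_def matrix_vector_mult_diff_rdistrib inner_diff_right scaleR_matrix_vector_assoc[symmetric]
              outer_quadratic_form field_simps)
      qed
      moreover have "transpose T = T"
        using less.prems by (simp add: T_def transpose_linear transpose_outer psd_matrices_def)
      ultimately show ?thesis by (simp add: psd_matrices_def)
    qed
    moreover have "card {j. T $ j \<noteq> 0} < card {j. S $ j \<noteq> 0}"
    proof (rule psubset_card_mono)
      have "T $ j = 0" if "S $ j = 0" for j
      proof -
        have "S $ i $ j = 0" using that sym[of i j] by simp
        then show ?thesis using that by (simp add: vec_eq_iff T_comp)
      qed
      moreover have "T $ i = 0" using i by (simp add: vec_eq_iff T_comp)
      moreover have "S $ i \<noteq> 0" using i by (metis less_irrefl zero_index)
      ultimately show "{j. T $ j \<noteq> 0} \<subset> {j. S $ j \<noteq> 0}" by blast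
    qed simp
    ultimately have "0 \<le> T \<bullet> N" using less.hyps by blast
    moreover have "0 \<le> (v \<otimes>\<^sub>v v) \<bullet> N"
      using N by (simp add: inner_commute[of _ N] inner_outer psd_matrices_def)
    then have "0 \<le> (1 / S $ i $ i) * ((v \<otimes>\<^sub>v v) \<bullet> N)" using i by simp
    moreover have "S \<bullet> N = T \<bullet> N + (1 / S $ i $ i) * ((v \<otimes>\<^sub>v v) \<bullet> N)"
      by (simp add: T_def inner_diff_left)
    ultimately show ?thesis by linarith
  qed
qed

lemma inner_transpose: "transpose A \<bullet> B = A \<bullet> transpose B" for A :: "real ^ 'k ^ 'k"
  unfolding inner_vec_def transpose_def by (simp, rule sum.swap)

section \<open>Duality for the moment-based ambiguity set\<close>

definition feasible_moments ::
  "real ^ 'k \<Rightarrow> real ^ 'k ^ 'k \<Rightarrow> real \<Rightarrow> real \<Rightarrow> ((real ^ 'k) \<times> (real ^ 'k ^ 'k)) set"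
  where "feasible_moments \<mu> \<Sigma> m\<^sub>1 m\<^sub>2 = {(k, A). norm (k - \<mu>) \<le> m\<^sub>1 \<and> A \<le>\<^sub>L m\<^sub>2 *\<^sub>R \<Sigma>}"

lemma feasible_moments_eq:
  "feasible_moments \<mu> \<Sigma> m\<^sub>1 m\<^sub>2 = cball \<mu> m\<^sub>1 \<times> (\<lambda>N. m\<^sub>2 *\<^sub>R \<Sigma> - N) ` psd_matrices"
proof -
  have "A \<le>\<^sub>L m\<^sub>2 *\<^sub>R \<Sigma> \<longleftrightarrow> A \<in> (\<lambda>N. m\<^sub>2 *\<^sub>R \<Sigma> - N) ` psd_matrices" for A
    unfolding loewner_le_def by (auto simp: image_iff intro!: bexI[of _ "m\<^sub>2 *\<^sub>R \<Sigma> - A"])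
  then show ?thesis by (auto simp: feasible_moments_def dist_norm norm_minus_commute)
qed

lemma feasible_moments_convex: "convex (feasible_moments \<mu> \<Sigma> m\<^sub>1 m\<^sub>2)"
proof -
  have "(\<lambda>N. m\<^sub>2 *\<^sub>R \<Sigma> - N) ` psd_matrices = (\<lambda>N. m\<^sub>2 *\<^sub>R \<Sigma> + N) ` uminus ` psd_matrices"
    by (simp add: image_image)
  then show ?thesis unfolding feasible_moments_eq
    by (simp add: convex_Times convex_translation convex_negations psd_matrices_convex)
qed

lemma feasible_moments_closed: "closed (feasible_moments \<mu> \<Sigma> m\<^sub>1 m\<^sub>2)"
proof -
  have "(\<lambda>N. m\<^sub>2 *\<^sub>R \<Sigma> - N) ` psd_matrices = (\<lambda>N. m\<^sub>2 *\<^sub>R \<Sigma> + N) ` uminus ` psd_matrices"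
    by (simp add: image_image)
  then show ?thesis unfolding feasible_moments_eq
    by (simp add: closed_Times closed_translation closed_negations psd_matrices_closed)
qed

text \<open>A functional that is bounded below on the feasible moments has the form required by the dual
problem. Feasible second moments are unbounded in the directions \<open>- x \<otimes>\<^sub>v x\<close>, so the quadratic form
of \<open>W\<close> is nonpositive and the negative of its symmetric part is \<open>S\<close>. The worst first moment is the
point \<open>\<mu> - m\<^sub>1 \<tau>\<close> of the ball, with \<open>\<tau>\<close> the direction of \<open>y\<close> (zero when \<open>y\<close> is zero).\<close>

lemma multipliers_of_functional:
  fixes \<mu> y :: "real ^ 'k" and \<Sigma> W :: "real ^ 'k ^ 'k"
  assumes \<Sigma>: "transpose \<Sigma> = \<Sigma>" and "0 \<le> m\<^sub>1"
    and bound: "\<And>k. k \<in> feasible_moments \<mu> \<Sigma> m\<^sub>1 m\<^sub>2 \<Longrightarrow> c - (y, W) \<bullet> k \<le> s"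
  obtains l \<tau> S where "0 \<le> l" "norm \<tau> \<le> 1" "S \<in> psd_matrices" "l *\<^sub>R \<tau> = y"
    "\<And>A. transpose A = A \<Longrightarrow> S \<bullet> A = - (W \<bullet> A)"
    "l * m\<^sub>1 - l * (\<tau> \<bullet> \<mu>) + m\<^sub>2 * (S \<bullet> \<Sigma>) + c \<le> s"
proof -
  define l where "l = norm y"
  define \<tau> where "\<tau> = sgn y"
  define S where "S = - (1 / 2) *\<^sub>R (W + transpose W)"
  have \<tau>: "norm \<tau> \<le> 1" "l *\<^sub>R \<tau> = y" "y \<bullet> \<tau> = l"
    by (cases "y = 0"; simp add: \<tau>_def l_def norm_sgn sgn_div_norm
        power2_norm_eq_inner[symmetric] power2_eq_square)+
  have S: "S \<bullet> A = - (W \<bullet> A)" if "transpose A = A" for A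
    using that by (simp add: S_def inner_add_left inner_transpose)
  have b: "c - (y \<bullet> k + W \<bullet> (m\<^sub>2 *\<^sub>R \<Sigma> - N)) \<le> s" if "norm (k - \<mu>) \<le> m\<^sub>1" "N \<in> psd_matrices" for k N
    using bound[of "(k, m\<^sub>2 *\<^sub>R \<Sigma> - N)"] that by (auto simp: feasible_moments_def loewner_le_def)
  have W: "W \<bullet> (x \<otimes>\<^sub>v x) \<le> 0" for x
  proof (rule ccontr)
    assume "\<not> W \<bullet> (x \<otimes>\<^sub>v x) \<le> 0"
    then have p: "0 < W \<bullet> (x \<otimes>\<^sub>v x)" by simp
    define d where "d = s - c + y \<bullet> \<mu> + W \<bullet> (m\<^sub>2 *\<^sub>R \<Sigma>)"
    define t where "t = max 0 ((d + 1) / (W \<bullet> (x \<otimes>\<^sub>v x)))"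
    have "t * (W \<bullet> (x \<otimes>\<^sub>v x)) \<le> d"
      using b[of \<mu> "t *\<^sub>R (x \<otimes>\<^sub>v x)"] \<open>0 \<le> m\<^sub>1\<close> psd_matrices_scaleR[OF outer_psd, of t x]
      by (simp add: inner_diff_right d_def t_def)
    moreover have "d + 1 \<le> t * (W \<bullet> (x \<otimes>\<^sub>v x))"
      using p by (simp add: t_def pos_divide_le_eq[symmetric])
    ultimately show False by simp
  qed
  have "S \<in> psd_matrices"
  proof -
    have "0 \<le> x \<bullet> (S *v x)" for x
      using W[of x] S[OF transpose_outer[of x]] by (simp add: inner_outer)
    moreover have "transpose S = S"
      unfolding S_def transpose_linear transpose_transpose by (simp add: add.commute)
    ultimately show ?thesis by (simp add: psd_matrices_def)
  qed
  moreover have "l * m\<^sub>1 - l * (\<tau> \<bullet> \<mu>) + m\<^sub>2 * (S \<bullet> \<Sigma>) + c \<le> s"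
  proof -
    have "norm (\<mu> - m\<^sub>1 *\<^sub>R \<tau> - \<mu>) \<le> m\<^sub>1"
      using \<tau>(1) \<open>0 \<le> m\<^sub>1\<close> by (simp add: mult_left_le)
    from b[OF this psd_matrices_zero] have "c - y \<bullet> \<mu> + m\<^sub>1 * l - m\<^sub>2 * (W \<bullet> \<Sigma>) \<le> s"
      by (simp add: inner_diff_right \<tau>(3))
    moreover have "l * (\<tau> \<bullet> \<mu>) = y \<bullet> \<mu>" by (simp flip: \<tau>(2))
    ultimately show ?thesis using S[OF \<Sigma>] by (simp add: mult.commute)
  qed
  ultimately show ?thesis using that[of l \<tau> S] \<tau> S by (simp add: l_def)
qed

lemma le_ereal_if_above_reals:
  fixes x y :: ereal
  assumes "\<And>s. x < ereal s \<Longrightarrow> y \<le> ereal s"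
  shows "y \<le> x"
proof (rule ccontr)
  assume "\<not> y \<le> x"
  then have "x < y" by simp
  then obtain s where "x < ereal s" "ereal s < y" using ereal_dense2 by blast
  then show False using assms[of s] by simp
qed

theorem proposition2p2:
  fixes \<Xi> :: "(real ^ 'k) set"
    and f :: "real ^ 'k \<Rightarrow> real"
    and \<mu>\<^sub>0 :: "real ^ 'k"
    and \<Sigma>\<^sub>0 :: "real ^ 'k ^ 'k"
    and m\<^sub>1 m\<^sub>2 \<epsilon> :: real
  assumes "compact \<Xi>"
    and "emeasure lborel \<Xi> > 0"
    and "continuous_on \<Xi> f"
    and "\<Sigma>\<^sub>0 \<in> pd_matrices"
    and "m\<^sub>1 > 0" and "m\<^sub>2 > 0" and "\<epsilon> > 0"
  shows
    "(SUP Q \<in> moment_ambiguity_set \<Xi> \<mu>\<^sub>0 \<Sigma>\<^sub>0 m\<^sub>1 m\<^sub>2.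
        ereal (\<integral>\<xi>. f \<xi> \<partial>Q) - ereal \<epsilon> * rel_entropy (truncated_gaussian \<Xi> \<mu>\<^sub>0 \<Sigma>\<^sub>0) Q)
     = (INF (l, \<tau>, S) \<in> {0..} \<times> {\<tau>. norm \<tau> \<le> 1} \<times> psd_matrices.
          ereal (l * m\<^sub>1 - l * (\<tau> \<bullet> \<mu>\<^sub>0) + m\<^sub>2 * (S :\<^sub>F \<Sigma>\<^sub>0)
            + \<epsilon> * ln (\<integral>\<xi>. exp ((f \<xi> + l * (\<tau> \<bullet> \<xi>)
                                    - S :\<^sub>F ((\<xi> - \<mu>\<^sub>0) \<otimes>\<^sub>v (\<xi> - \<mu>\<^sub>0))) / \<epsilon>)
                          \<partial>truncated_gaussian \<Xi> \<mu>\<^sub>0 \<Sigma>\<^sub>0)))"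
    (is "(SUP Q \<in> ?A. ?value Q) = (INF (l, \<tau>, S) \<in> ?X. ereal (?dual l \<tau> S))")
proof -
  define P where "P = truncated_gaussian \<Xi> \<mu>\<^sub>0 \<Sigma>\<^sub>0"
  define outer2 where "outer2 \<xi> = (\<xi> - \<mu>\<^sub>0) \<otimes>\<^sub>v (\<xi> - \<mu>\<^sub>0)" for \<xi>
  define h where "h \<xi> = (\<xi>, outer2 \<xi>)" for \<xi>
  define K where "K = feasible_moments \<mu>\<^sub>0 \<Sigma>\<^sub>0 m\<^sub>1 m\<^sub>2"
  have P: "prob_space P" and sets_P: "sets P = sets (restrict_space borel \<Xi>)"
    unfolding P_def using assms(1,2) by (rule prob_space_truncated_gaussian sets_truncated_gaussian)+
  have space_P: "space P = \<Xi>"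
    using sets_eq_imp_space_eq[OF sets_P] by (simp add: space_restrict_space)
  have borel_P: "g \<in> borel_measurable P" if "continuous_on \<Xi> g" for g :: "_ \<Rightarrow> 'b::topological_space"
    using borel_measurable_continuous_on_restrict[OF that] by (subst measurable_cong_sets[OF sets_P refl])
  have cont_outer2: "continuous_on \<Xi> outer2"
    unfolding outer2_def outer_def by (intro continuous_intros)
  have cont_h: "continuous_on \<Xi> h"
    unfolding h_def by (intro continuous_intros cont_outer2)
  obtain B where B: "\<And>\<xi>. \<xi> \<in> \<Xi> \<Longrightarrow> norm (f \<xi>, h \<xi>) \<le> B"
    using compact_imp_bounded[OF compact_continuous_image[OF continuous_on_Pair[OF assms(3) cont_h] assms(1)]]
    unfolding bounded_iff by blast
  interpret P: moment_problem P f h B \<epsilon>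
  proof (rule moment_problem.intro[OF P], unfold_locales)
    show "\<bar>f \<xi>\<bar> \<le> B" "norm (h \<xi>) \<le> B" if "\<xi> \<in> space P" for \<xi>
      using B[of \<xi>] that norm_fst_le[of "f \<xi>" "h \<xi>"] norm_snd_le[of "h \<xi>" "f \<xi>"] by (auto simp: space_P)
  qed (use assms cont_h borel_P in auto)

  have moment_fst: "fst (P.moment q) = (\<integral>\<xi>. \<xi> \<partial>density P q)"
    and moment_snd: "snd (P.moment q) = (\<integral>\<xi>. outer2 \<xi> \<partial>density P q)"
    and expect_f: "(\<integral>\<xi>. f \<xi> \<partial>density P q) = (\<integral>\<xi>. q \<xi> * f \<xi> \<partial>P)"
    if q: "q \<in> entropy_densities P" for q
  proof -
    have [measurable]: "q \<in> borel_measurable P" and q0: "\<And>\<xi>. 0 \<le> q \<xi>"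
      using q by (auto simp: entropy_densities_def)
    note D = integral_density[of _ P q]
    show "fst (P.moment q) = (\<integral>\<xi>. \<xi> \<partial>density P q)"
      unfolding P.moment_def
      using integral_bounded_linear[OF bounded_linear_fst P.integrable_density_h[OF q]] q0
      by (subst D) (auto intro: borel_P continuous_on_id simp: h_def)
    show "snd (P.moment q) = (\<integral>\<xi>. outer2 \<xi> \<partial>density P q)"
      unfolding P.moment_def
      using integral_bounded_linear[OF bounded_linear_snd P.integrable_density_h[OF q]] q0
      by (subst D) (auto intro: borel_P cont_outer2 simp: h_def)
    show "(\<integral>\<xi>. f \<xi> \<partial>density P q) = (\<integral>\<xi>. q \<xi> * f \<xi> \<partial>P)"
      using q0 by (subst D) (auto intro: borel_P assms)
  qed
  have in_A: "density P q \<in> ?A \<longleftrightarrow> P.moment q \<in> K" if q: "q \<in> entropy_densities P" for q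
  proof -
    have "(\<integral>\<^sup>+\<xi>. ennreal (q \<xi>) \<partial>P) = 1"
      using q nn_integral_eq_integral[of P q] by (auto simp: entropy_densities_def)
    then have "prob_space (density P q)"
      using q by (intro prob_spaceI) (auto simp: emeasure_density entropy_densities_def cong: nn_integral_cong)
    then have "density P q \<in> prob_measures_on \<Xi>"
      by (simp add: prob_measures_on_def space_prob_algebra sets_P)
    then show ?thesis
      unfolding moment_ambiguity_set_def K_def feasible_moments_def
      using moment_fst[OF q] moment_snd[OF q] by (cases "P.moment q") (simp add: outer2_def)
  qed
  have value_density: "?value (density P q) = ereal (P.objective q)" if q: "q \<in> entropy_densities P" for q
    using P.rel_entropy_entropy_density[OF q] expect_f[OF q] by (simp add: P_def[symmetric] P.objective_def)
  have dual_eq: "?dual l \<tau> S = l * m\<^sub>1 - l * (\<tau> \<bullet> \<mu>\<^sub>0) + m\<^sub>2 * (S \<bullet> \<Sigma>\<^sub>0) + P.log_partition (l *\<^sub>R \<tau>, - S)" for l \<tau> S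
    by (simp add: P.log_partition_def frobenius_eq_inner h_def outer2_def P_def[symmetric] add_diff_eq)

  \<comment> \<open>The Gibbs inequality, with multiplier times slack nonnegative in both constraints.\<close>
  have weak: "?value Q \<le> ereal (?dual l \<tau> S)"
    if Q: "Q \<in> ?A" and X: "0 \<le> l" "norm \<tau> \<le> 1" "S \<in> psd_matrices" for Q l \<tau> S
  proof (cases "rel_entropy P Q = \<infinity>")
    case True
    then show ?thesis using \<open>\<epsilon> > 0\<close> by (simp add: P_def)
  next
    case False
    have "prob_space Q" "sets Q = sets P"
      using Q by (auto simp: moment_ambiguity_set_def prob_measures_on_def space_prob_algebra sets_P)
    then obtain q where q: "q \<in> entropy_densities P" and Qq: "Q = density P q"
      using P.finite_rel_entropy_imp_density False by blast
    obtain k A where kA: "P.moment q = (k, A)" by (cases "P.moment q")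
    have "(k, A) \<in> K" using in_A[OF q] Q kA by (simp add: Qq)
    then have k: "norm (k - \<mu>\<^sub>0) \<le> m\<^sub>1" and N: "m\<^sub>2 *\<^sub>R \<Sigma>\<^sub>0 - A \<in> psd_matrices"
      by (auto simp: K_def feasible_moments_def loewner_le_def)
    have "\<tau> \<bullet> (\<mu>\<^sub>0 - k) \<le> norm \<tau> * norm (\<mu>\<^sub>0 - k)" by (rule norm_cauchy_schwarz)
    also have "\<dots> \<le> 1 * m\<^sub>1" using X k by (intro mult_mono) (auto simp: norm_minus_commute)
    finally have "l * (\<tau> \<bullet> (\<mu>\<^sub>0 - k)) \<le> l * m\<^sub>1" using X by (intro mult_left_mono) auto
    moreover have "0 \<le> S \<bullet> (m\<^sub>2 *\<^sub>R \<Sigma>\<^sub>0 - A)" by (rule psd_inner_nonneg[OF X(3) N])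
    moreover have "P.objective q + (l *\<^sub>R \<tau>, - S) \<bullet> (k, A) \<le> P.log_partition (l *\<^sub>R \<tau>, - S)"
      using P.Gibbs_inequality[OF q, of "(l *\<^sub>R \<tau>, - S)"] by (simp only: kA)
    ultimately have "P.objective q \<le> ?dual l \<tau> S"
      unfolding dual_eq by (simp add: inner_diff_right right_diff_distrib)
    then show ?thesis unfolding Qq value_density[OF q] by simp
  qed

  \<comment> \<open>Separation applies because no density attains the level \<open>s\<close> under the constraint.\<close>
  have strong: "(INF (l, \<tau>, S) \<in> ?X. ereal (?dual l \<tau> S)) \<le> ereal s"
    if s: "(SUP Q \<in> ?A. ?value Q) < ereal s" for s
  proof -
    have sym: "transpose \<Sigma>\<^sub>0 = \<Sigma>\<^sub>0" using assms(4) by (simp add: pd_matrices_def)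
    have "(\<mu>\<^sub>0, m\<^sub>2 *\<^sub>R \<Sigma>\<^sub>0) \<in> K"
      using assms psd_matrices_zero by (simp add: K_def feasible_moments_def loewner_le_def)
    moreover have "P.objective q < s" if q: "q \<in> entropy_densities P" "P.moment q \<in> K" for q
    proof -
      have "density P q \<in> ?A" using in_A q by simp
      then have "?value (density P q) \<le> (SUP Q \<in> ?A. ?value Q)" by (rule SUP_upper)
      also note s
      finally show ?thesis unfolding value_density[OF q(1)] by simp
    qed
    ultimately obtain w where w: "\<And>k. k \<in> K \<Longrightarrow> P.log_partition w - w \<bullet> k \<le> s"
      using P.dual_certificate[of K s] feasible_moments_convex feasible_moments_closed unfolding K_def by blast
    obtain y W where yW: "w = (y, W)" by (cases w)
    obtain l \<tau> S where X: "0 \<le> l" "norm \<tau> \<le> 1" "S \<in> psd_matrices"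
      and y: "l *\<^sub>R \<tau> = y" and S: "\<And>A. transpose A = A \<Longrightarrow> S \<bullet> A = - (W \<bullet> A)"
      and le: "l * m\<^sub>1 - l * (\<tau> \<bullet> \<mu>\<^sub>0) + m\<^sub>2 * (S \<bullet> \<Sigma>\<^sub>0) + P.log_partition w \<le> s"
      using multipliers_of_functional[OF sym, of m\<^sub>1 \<mu>\<^sub>0 m\<^sub>2 "P.log_partition w" y W s] w assms
      unfolding K_def yW by (metis less_imp_le)
    \<comment> \<open>Second moments are symmetric matrices, so \<open>W\<close> and \<open>- S\<close> tilt the payoff in the same way.\<close>
    have "w \<bullet> h \<xi> = (l *\<^sub>R \<tau>, - S) \<bullet> h \<xi>" for \<xi>
      using S[OF transpose_outer, of "\<xi> - \<mu>\<^sub>0"] by (simp add: yW h_def outer2_def y)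
    then have "P.log_partition w = P.log_partition (l *\<^sub>R \<tau>, - S)"
      by (simp add: P.log_partition_def)
    then have "?dual l \<tau> S \<le> s" using le unfolding dual_eq by simp
    then show ?thesis
      using X by (intro INF_lower2[of "(l, \<tau>, S)"]) auto
  qed

  show ?thesis
  proof (rule antisym)
    show "(SUP Q \<in> ?A. ?value Q) \<le> (INF (l, \<tau>, S) \<in> ?X. ereal (?dual l \<tau> S))"
    proof (intro SUP_least INF_greatest)
      fix Q x assume Q: "Q \<in> ?A" and x: "x \<in> ?X"
      obtain l \<tau> S where lts: "x = (l, \<tau>, S)" by (rule prod_cases3)
      have "?value Q \<le> ereal (?dual l \<tau> S)" by (rule weak[OF Q]) (use x lts in simp_all)
      then show "?value Q \<le> (case x of (l, \<tau>, S) \<Rightarrow> ereal (?dual l \<tau> S))"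
        by (simp only: lts prod.case)
    qed
    show "(INF (l, \<tau>, S) \<in> ?X. ereal (?dual l \<tau> S)) \<le> (SUP Q \<in> ?A. ?value Q)"
      by (rule le_ereal_if_above_reals) (rule strong)
  qed
qed

end
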